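(* Every combinatorial arena $\mathscr{A}$ can be obtained, up to graph isomorphisms $\cong$ on the underlying finite rooted forest $|\mathscr{A}|$, from top and/or one by tensorial negation, linear implication, tensor, with and/or of-course ($!$).
   Context: A rooted forest is written $F=(\mathscr{R}_F,\mathscr{V}_F,\mathscr{E}_F)$ (roots, vertices, edges); a set of vertices is fraternal in $F$ if it is nonempty and its elements are pairwise siblings (all roots or with a common parent). For an element $\star$, $\star.F$ is the rooted tree obtained by adding $\star$ as a new root above all roots of $F$; $F_X$ is the largest rooted subforest of $F$ with roots in $X\cap\mathscr{V}_F$; $F{\upharpoonright_Y}$ is the subforest induced by $Y\cap\mathscr{V}_F$. A multiplicative structure on a finite rooted forest $F$ is a finite rooted forest $\mu$ with $\mathscr{V}_\mu=\mathscr{V}_F$ such that the vertex set of every nonempty path in $\mu$ is fraternal in $F$; a vertex is switching if it is not a leaf in $\mu$. An additive structure on $(F,\mu)$ is $\alpha=\alpha[0]\cup\alpha[2]$ with $\alpha[0]$ a set of leaves of $F$ that are not switching and $\alpha[2]$ a set of edges between siblings in $\mu$. An exponential structure on $(F,\mu)$ is a finite rooted forest $\epsilon$ whose vertices are pairs $(S,i)$ with $S$ fraternal in $\mu$ and $i$ a natural number unique among such second components, whose edges $(S,i)\to(T,j)$ are instances of $S\supseteq T$, and whose roots have pairwise disjoint first components. A combinatorial arena is $\mathscr{A}=(|\mathscr{A}|,\mu_{\mathscr{A}},\alpha_{\mathscr{A}},\epsilon_{\mathscr{A}})$ with such structures, admitting for each maximal fraternal set $S$ in $\mu_{\mathscr{A}}$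 an exhaustive recursive partition (a rooted tree of nonempty subsets with root $S$, each non-leaf's children forming a partition of it into more than one part, leaves singletons) such that for every partition $\{S_i\}_{i\in I}$ occurring in it: (1) the relation "$\{x,y\}\in\alpha_{\mathscr{A}}[2]$" between $S_i\ni x$ and $S_j\ni y$ is independent of representatives; (2) the induced graph on $\{S_i\}_{i\in I}$ is null or complete; (3) for every vertex $V$ of $\epsilon_{\mathscr{A}}$, $V\cap S_i\neq\emptyset$ implies $V\subseteq S_i$ or $S_i\subseteq V$. Constructions: top $\top=(\emptyset,\emptyset,\emptyset,\emptyset)$; one $1=(1,1,\{1\},\emptyset)$; tensorial negation $\neg\mathscr{A}$: $|\neg\mathscr{A}|=\neg.|\mathscr{A}|$, $\mu=\neg\uplus\mu_{\mathscr{A}}$, $\alpha,\epsilon$ unchanged; tensor $\mathscr{A}\otimes\mathscr{B}$: componentwise disjoint union of all four components; with $\mathscr{A}\mathbin{\&}\mathscr{B}$: as tensor but adding to $\alpha[2]$ all edges $\{a,b\}$ with $a$ a root of both $|\mathscr{A}|$ and $\mu_{\mathscr{A}}$, $b$ a root of both $|\mathscr{B}|$ and $\mu_{\mathscr{B}}$; of-course $!\mathscr{A}$: same $|\mathscr{A}|,\mu_{\mathscr{A}},\alpha_{\mathscr{A}}$ and $\epsilon_{!\mathscr{A}}=\big(R.(\epsilon_{\mathscr{A}})_{\wp(R)}\big)\uplus\big(\epsilon_{\mathscr{A}}{\upharpoonright_{\wp(\mathscr{V}_{|\mathscr{A}|}\setminus R)}}\big)$ where $R=\mathscr{R}_{|\mathscr{A}|}\cap\mathscr{R}_{\mu_{\mathscr{A}}}$;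 linear implication $\mathscr{A}\multimap\mathscr{B}$: $|\mathscr{A}\multimap\mathscr{B}|={\multimap}.|\mathscr{A}|\uplus|\mathscr{B}|$, $\mu=\mu_{\mathscr{A}}\uplus\mu_{\mathscr{B}}{\upharpoonright_{\mathscr{V}^{\geqslant1}_{|\mathscr{B}|}}}\uplus{\multimap}.(\mu_{\mathscr{B}}{\upharpoonright_{\mathscr{R}_{|\mathscr{B}|}}})$, $\alpha,\epsilon$ disjoint unions.
   Formalization: Read literally the claim fails; here sets fraternal in μ (for α[2], ε and the maximal fraternal sets) must also be fraternal in |A|, and disjointness of first components in ε is required of all distinct siblings, not only of roots. Of-course is applied only when R is nonempty. *)

theory Defs
  imports Main "HOL-Library.Disjoint_Sets"
begin

subsection \<open>Finite rooted forests\<close>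

(* Edges are directed from parent to child. *)
record 'v forest =
  roots :: "'v set"
  verts :: "'v set"
  edges :: "('v \<times> 'v) set"

definition rooted_forest :: "'v forest \<Rightarrow> bool" where
  "rooted_forest F \<longleftrightarrow>
     finite (verts F) \<and> edges F \<subseteq> verts F \<times> verts F \<and> acyclic (edges F) \<and>
     (\<forall>p q v. (p, v) \<in> edges F \<and> (q, v) \<in> edges F \<longrightarrow> p = q) \<and>
     roots F = {v \<in> verts F. \<forall>p. (p, v) \<notin> edges F}"

definition children :: "'v forest \<Rightarrow> 'v \<Rightarrow> 'v set" where
  "children F v = {w. (v, w) \<in> edges F}"

definition leaf :: "'v forest \<Rightarrow> 'v \<Rightarrow> bool" where
  "leaf F v \<longleftrightarrow> v \<in> verts F \<and> children F v = {}"

(* Reflexive on the vertices. *)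
definition siblings :: "'v forest \<Rightarrow> 'v \<Rightarrow> 'v \<Rightarrow> bool" where
  "siblings F x y \<longleftrightarrow>
     (x \<in> roots F \<and> y \<in> roots F) \<or> (\<exists>p. (p, x) \<in> edges F \<and> (p, y) \<in> edges F)"

definition fraternal :: "'v forest \<Rightarrow> 'v set \<Rightarrow> bool" where
  "fraternal F S \<longleftrightarrow> S \<noteq> {} \<and> (\<forall>x\<in>S. \<forall>y\<in>S. siblings F x y)"

definition path :: "'v forest \<Rightarrow> 'v list \<Rightarrow> bool" where
  "path F xs \<longleftrightarrow> set xs \<subseteq> verts F \<and> successively (\<lambda>x y. (x, y) \<in> edges F) xs"

definition empty_forest :: "'v forest" where
  "empty_forest = \<lparr>roots = {}, verts = {}, edges = {}\<rparr>"

definition point :: "'v \<Rightarrow> 'v forest" where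
  "point s = \<lparr>roots = {s}, verts = {s}, edges = {}\<rparr>"

(* Used only for forests with disjoint vertex sets. *)
definition forest_union :: "'v forest \<Rightarrow> 'v forest \<Rightarrow> 'v forest" (infixl "\<uplus>\<^sub>F" 65) where
  "F \<uplus>\<^sub>F G = \<lparr>roots = roots F \<union> roots G, verts = verts F \<union> verts G, edges = edges F \<union> edges G\<rparr>"

(* The tree s.F; used only for s that is not a vertex of F. *)
definition add_root :: "'v \<Rightarrow> 'v forest \<Rightarrow> 'v forest" where
  "add_root s F =
     \<lparr>roots = {s}, verts = insert s (verts F), edges = {s} \<times> roots F \<union> edges F\<rparr>"

definition induced :: "'v forest \<Rightarrow> 'v set \<Rightarrow> 'v forest" where
  "induced F Y =
     \<lparr>roots = {v \<in> verts F \<inter> Y. \<forall>p\<in>Y. (p, v) \<notin> edges F},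
      verts = verts F \<inter> Y,
      edges = edges F \<inter> Y \<times> Y\<rparr>"

(* The largest rooted subforest with roots in X: the members of X and all their descendants. *)
definition subforest_below :: "'v forest \<Rightarrow> 'v set \<Rightarrow> 'v forest" where
  "subforest_below F X = induced F ((edges F)\<^sup>* `` (X \<inter> verts F))"

definition forest_iso :: "('v \<Rightarrow> 'w) \<Rightarrow> 'v forest \<Rightarrow> 'w forest \<Rightarrow> bool" where
  "forest_iso f F G \<longleftrightarrow>
     bij_betw f (verts F) (verts G) \<and> f ` roots F = roots G \<and>
     (\<forall>x\<in>verts F. \<forall>y\<in>verts F. (x, y) \<in> edges F \<longleftrightarrow> (f x, f y) \<in> edges G)"


subsection \<open>Multiplicative, additive and exponential structures\<close>

definition multiplicative_structure :: "'v forest \<Rightarrow> 'v forest \<Rightarrow> bool" where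
  "multiplicative_structure F \<mu> \<longleftrightarrow>
     rooted_forest \<mu> \<and> verts \<mu> = verts F \<and>
     (\<forall>xs. path \<mu> xs \<and> xs \<noteq> [] \<longrightarrow> fraternal F (set xs))"

definition switching :: "'v forest \<Rightarrow> 'v \<Rightarrow> bool" where
  "switching \<mu> v \<longleftrightarrow> v \<in> verts \<mu> \<and> \<not> leaf \<mu> v"

(* Fraternity in a multiplicative structure \<mu> on F is taken among siblings of F.
   For vertices with a common parent in \<mu> this is automatic; it matters only for roots of \<mu>,
   which may lie under different parents in F and are then not counted as siblings.
   (Accordingly the constructions "with" and "of-course" below act on the common roots of F
   and \<mu>; they never join roots of \<mu> from different places of F.) *)
definition mfraternal :: "'v forest \<Rightarrow> 'v forest \<Rightarrow> 'v set \<Rightarrow> bool" where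
  "mfraternal F \<mu> S \<longleftrightarrow> fraternal F S \<and> fraternal \<mu> S"

definition additive_structure ::
  "'v forest \<Rightarrow> 'v forest \<Rightarrow> 'v set \<Rightarrow> 'v set set \<Rightarrow> bool" where
  "additive_structure F \<mu> \<alpha>0 \<alpha>2 \<longleftrightarrow>
     \<alpha>0 \<subseteq> {v. leaf F v \<and> \<not> switching \<mu> v} \<and>
     \<alpha>2 \<subseteq> {{x, y} | x y. x \<noteq> y \<and> mfraternal F \<mu> {x, y}}"

(* Disjointness is required of the roots of \<epsilon> and, hereditarily, of the roots below each
   vertex, i.e. of any two distinct siblings. Without the hereditary form a vertex ({x}, 0)
   could have the two children ({x}, 1) and ({x}, 2), whereas of-course puts a single new root
   above a forest whose roots are disjoint. *)
definition exponential_structure ::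
  "'v forest \<Rightarrow> 'v forest \<Rightarrow> ('v set \<times> nat) forest \<Rightarrow> bool" where
  "exponential_structure F \<mu> \<epsilon> \<longleftrightarrow>
     rooted_forest \<epsilon> \<and>
     (\<forall>V\<in>verts \<epsilon>. mfraternal F \<mu> (fst V)) \<and>
     inj_on snd (verts \<epsilon>) \<and>
     (\<forall>V W. (V, W) \<in> edges \<epsilon> \<longrightarrow> fst W \<subseteq> fst V) \<and>
     (\<forall>V W. siblings \<epsilon> V W \<and> V \<noteq> W \<longrightarrow> fst V \<inter> fst W = {})"


subsection \<open>Combinatorial arenas\<close>

(* add0 and add2 are the components \<alpha>[0] (vertices) and \<alpha>[2] (two-element sets of vertices) of
   the additive structure. *)
record 'v arena =
  frst :: "'v forest"
  mult :: "'v forest"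
  add0 :: "'v set"
  add2 :: "'v set set"
  expo :: "('v set \<times> nat) forest"

definition exhaustive_recursive_partition :: "'v set \<Rightarrow> 'v set forest \<Rightarrow> bool" where
  "exhaustive_recursive_partition S T \<longleftrightarrow>
     rooted_forest T \<and> roots T = {S} \<and> (\<forall>N\<in>verts T. N \<noteq> {} \<and> N \<subseteq> S) \<and>
     (\<forall>N\<in>verts T.
        if leaf T N then is_singleton N
        else partition_on N (children T N) \<and> card (children T N) > 1)"

definition part_adjacent :: "'v set set \<Rightarrow> 'v set \<Rightarrow> 'v set \<Rightarrow> bool" where
  "part_adjacent \<alpha>2 X Y \<longleftrightarrow> (\<exists>x\<in>X. \<exists>y\<in>Y. {x, y} \<in> \<alpha>2)"

definition compatible_partition ::
  "'v set set \<Rightarrow> ('v set \<times> nat) forest \<Rightarrow> 'v set set \<Rightarrow> bool" where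
  "compatible_partition \<alpha>2 \<epsilon> P \<longleftrightarrow>
     (\<forall>X\<in>P. \<forall>Y\<in>P. X \<noteq> Y \<longrightarrow>
        (\<forall>x\<in>X. \<forall>x'\<in>X. \<forall>y\<in>Y. \<forall>y'\<in>Y. {x, y} \<in> \<alpha>2 \<longleftrightarrow> {x', y'} \<in> \<alpha>2)) \<and>
     ((\<forall>X\<in>P. \<forall>Y\<in>P. X \<noteq> Y \<longrightarrow> \<not> part_adjacent \<alpha>2 X Y) \<or>
      (\<forall>X\<in>P. \<forall>Y\<in>P. X \<noteq> Y \<longrightarrow> part_adjacent \<alpha>2 X Y)) \<and>
     (\<forall>V\<in>verts \<epsilon>. \<forall>X\<in>P. fst V \<inter> X \<noteq> {} \<longrightarrow> fst V \<subseteq> X \<or> X \<subseteq> fst V)"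

definition maximal_mfraternal :: "'v forest \<Rightarrow> 'v forest \<Rightarrow> 'v set \<Rightarrow> bool" where
  "maximal_mfraternal F \<mu> S \<longleftrightarrow>
     mfraternal F \<mu> S \<and> (\<forall>S'. mfraternal F \<mu> S' \<and> S \<subseteq> S' \<longrightarrow> S' = S)"

definition combinatorial_arena :: "'v arena \<Rightarrow> bool" where
  "combinatorial_arena A \<longleftrightarrow>
     rooted_forest (frst A) \<and>
     multiplicative_structure (frst A) (mult A) \<and>
     additive_structure (frst A) (mult A) (add0 A) (add2 A) \<and>
     exponential_structure (frst A) (mult A) (expo A) \<and>
     (\<forall>S. maximal_mfraternal (frst A) (mult A) S \<longrightarrow>
        (\<exists>T. exhaustive_recursive_partition S T \<and>
             (\<forall>N\<in>verts T. \<not> leaf T N \<longrightarrow>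
                compatible_partition (add2 A) (expo A) (children T N))))"

(* An isomorphism of the underlying forests along which the three structures correspond. The
   numbers in the vertices of the exponential structure only serve to keep copies of a set
   apart, so they may be changed. *)
definition arena_iso :: "'v arena \<Rightarrow> 'w arena \<Rightarrow> bool" (infix "\<cong>\<^sub>A" 50) where
  "A \<cong>\<^sub>A B \<longleftrightarrow>
     (\<exists>f. forest_iso f (frst A) (frst B) \<and>
          forest_iso f (mult A) (mult B) \<and>
          f ` add0 A = add0 B \<and>
          (`) f ` add2 A = add2 B \<and>
          (\<exists>g. forest_iso g (expo A) (expo B) \<and>
               (\<forall>V\<in>verts (expo A). fst (g V) = f ` fst V)))"


subsection \<open>Constructions on arenas\<close>

definition common_roots :: "'v arena \<Rightarrow> 'v set" where
  "common_roots A = roots (frst A) \<inter> roots (mult A)"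

definition top_arena :: "'v arena" where
  "top_arena =
     \<lparr>frst = empty_forest, mult = empty_forest, add0 = {}, add2 = {}, expo = empty_forest\<rparr>"

definition one_arena :: "'v \<Rightarrow> 'v arena" where
  "one_arena s =
     \<lparr>frst = point s, mult = point s, add0 = {s}, add2 = {}, expo = empty_forest\<rparr>"

definition neg_arena :: "'v \<Rightarrow> 'v arena \<Rightarrow> 'v arena" where
  "neg_arena s A =
     \<lparr>frst = add_root s (frst A), mult = point s \<uplus>\<^sub>F mult A,
      add0 = add0 A, add2 = add2 A, expo = expo A\<rparr>"

definition tensor_arena :: "'v arena \<Rightarrow> 'v arena \<Rightarrow> 'v arena" where
  "tensor_arena A B =
     \<lparr>frst = frst A \<uplus>\<^sub>F frst B, mult = mult A \<uplus>\<^sub>F mult B,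
      add0 = add0 A \<union> add0 B, add2 = add2 A \<union> add2 B, expo = expo A \<uplus>\<^sub>F expo B\<rparr>"

definition with_arena :: "'v arena \<Rightarrow> 'v arena \<Rightarrow> 'v arena" where
  "with_arena A B =
     (tensor_arena A B)
       \<lparr>add2 := add2 A \<union> add2 B \<union> {{a, b} | a b. a \<in> common_roots A \<and> b \<in> common_roots B}\<rparr>"

definition ofcourse_arena :: "nat \<Rightarrow> 'v arena \<Rightarrow> 'v arena" where
  "ofcourse_arena i A =
     (let R = common_roots A in
      A\<lparr>expo :=
          add_root (R, i) (subforest_below (expo A) (Pow R \<times> UNIV))
          \<uplus>\<^sub>F induced (expo A) (Pow (verts (frst A) - R) \<times> UNIV)\<rparr>)"

definition lolli_arena :: "'v \<Rightarrow> 'v arena \<Rightarrow> 'v arena \<Rightarrow> 'v arena" where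
  "lolli_arena s A B =
     \<lparr>frst = add_root s (frst A) \<uplus>\<^sub>F frst B,
      mult = mult A
             \<uplus>\<^sub>F induced (mult B) (verts (frst B) - roots (frst B))
             \<uplus>\<^sub>F add_root s (induced (mult B) (roots (frst B))),
      add0 = add0 A \<union> add0 B, add2 = add2 A \<union> add2 B, expo = expo A \<uplus>\<^sub>F expo B\<rparr>"

definition disjoint_arenas :: "'v arena \<Rightarrow> 'v arena \<Rightarrow> bool" where
  "disjoint_arenas A B \<longleftrightarrow>
     verts (frst A) \<inter> verts (frst B) = {} \<and>
     snd ` verts (expo A) \<inter> snd ` verts (expo B) = {}"

(* Disjoint unions are unions of arenas with disjoint vertices and numbers, and added vertices
   are fresh. Since the empty set is not fraternal, of-course yields an arena only if the set
   of common roots is nonempty, i.e. if the arena is not top. *)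
inductive obtainable :: "'v arena \<Rightarrow> bool" where
  top: "obtainable top_arena"
| one: "obtainable (one_arena s)"
| neg: "obtainable A \<Longrightarrow> s \<notin> verts (frst A) \<Longrightarrow> obtainable (neg_arena s A)"
| lolli: "obtainable A \<Longrightarrow> obtainable B \<Longrightarrow> disjoint_arenas A B \<Longrightarrow>
    s \<notin> verts (frst A) \<union> verts (frst B) \<Longrightarrow> obtainable (lolli_arena s A B)"
| tensor: "obtainable A \<Longrightarrow> obtainable B \<Longrightarrow> disjoint_arenas A B \<Longrightarrow>
    obtainable (tensor_arena A B)"
| amp: "obtainable A \<Longrightarrow> obtainable B \<Longrightarrow> disjoint_arenas A B \<Longrightarrow>
    obtainable (with_arena A B)"
| ofcourse: "obtainable A \<Longrightarrow> common_roots A \<noteq> {} \<Longrightarrow> i \<notin> snd ` verts (expo A) \<Longrightarrow>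
    obtainable (ofcourse_arena i A)"

end

theory Submission
  imports Defs
begin

text \<open>The arena itself, not just an isomorphic copy, is built by the constructions, by induction on the
  number of vertices of the forest and of the exponential structure. Let \<open>R\<close> be the set of common
  roots of \<open>|A|\<close> and \<open>\<mu>\<close>. If \<open>R\<close> occurs in \<open>\<epsilon>\<close>, it occurs as a root, and removing that root undoes
  an of-course. Otherwise, if \<open>R\<close> has several elements, the top level of its recursive partition can
  be coarsened to two blocks that no member of \<open>\<epsilon>\<close> straddles and that are joined by all or none of
  the possible additive edges; sending each vertex to the \<open>\<mu>\<close>-root of its \<open>|A|\<close>-root extends the two
  blocks to a decomposition of \<open>A\<close> as a with or a tensor. If \<open>R = {r}\<close>, then \<open>A\<close> is one or a linear
  implication whose premise consists of the proper descendants of \<open>r\<close> in \<open>|A|\<close> and whose conclusion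
  of the rest; negation is the case of the conclusion top.\<close>

section \<open>Rooted forests\<close>

lemma rooted_forestD:
  assumes "rooted_forest F"
  shows "finite (verts F)" "edges F \<subseteq> verts F \<times> verts F" "acyclic (edges F)"
    and "(p, v) \<in> edges F \<Longrightarrow> (q, v) \<in> edges F \<Longrightarrow> p = q"
    and "v \<in> roots F \<longleftrightarrow> v \<in> verts F \<and> (\<forall>p. (p, v) \<notin> edges F)"
  using assms unfolding rooted_forest_def by blast+

lemma edge_verts:
  assumes "rooted_forest F" "(x, y) \<in> edges F"
  shows "x \<in> verts F" "y \<in> verts F"
  using assms rooted_forestD(2) by fastforce+

lemma induced_simps [simp]:
  "verts (induced F Y) = verts F \<inter> Y"
  "edges (induced F Y) = edges F \<inter> Y \<times> Y"
  "roots (induced F Y) = {v \<in> verts F \<inter> Y. \<forall>p\<in>Y. (p, v) \<notin> edges F}"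
  by (simp_all add: induced_def)

lemma add_root_simps [simp]:
  "verts (add_root s F) = insert s (verts F)"
  "edges (add_root s F) = {s} \<times> roots F \<union> edges F"
  "roots (add_root s F) = {s}"
  by (simp_all add: add_root_def)

lemma forest_union_simps [simp]:
  "verts (F \<uplus>\<^sub>F G) = verts F \<union> verts G"
  "edges (F \<uplus>\<^sub>F G) = edges F \<union> edges G"
  "roots (F \<uplus>\<^sub>F G) = roots F \<union> roots G"
  by (simp_all add: forest_union_def)

lemma forest_eqI:
  fixes F G :: "'v forest"
  assumes "verts F = verts G" "edges F = edges G" "roots F = roots G"
  shows "F = G"
  using assms by simp

lemma rooted_forest_induced:
  assumes "rooted_forest F"
  shows "rooted_forest (induced F Y)"
proof -
  have "acyclic (edges F \<inter> Y \<times> Y)"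
    using rooted_forestD(3)[OF assms] by (rule acyclic_subset) auto
  then show ?thesis
    using assms unfolding rooted_forest_def by auto
qed

lemma roots_induced_closed:
  assumes F: "rooted_forest F" and cl: "\<And>p v. (p, v) \<in> edges F \<Longrightarrow> v \<in> Y \<Longrightarrow> p \<in> Y"
  shows "roots (induced F Y) = roots F \<inter> Y"
proof (rule set_eqI)
  fix v
  show "v \<in> roots (induced F Y) \<longleftrightarrow> v \<in> roots F \<inter> Y"
    using cl[of _ v] rooted_forestD(5)[OF F, of v] unfolding induced_simps by blast
qed

section \<open>Siblings and fraternal sets, and their passage to induced subforests\<close>

lemma siblings_verts:
  assumes "rooted_forest F" "siblings F x y"
  shows "x \<in> verts F" "y \<in> verts F"
  using assms edge_verts[OF assms(1)] rooted_forestD(5)[OF assms(1)]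
  by (auto simp: siblings_def)

lemma siblings_sym: "siblings F x y \<Longrightarrow> siblings F y x"
  by (auto simp: siblings_def)

lemma siblings_trans:
  assumes F: "rooted_forest F" and xy: "siblings F x y" and yz: "siblings F y z"
  shows "siblings F x z"
  using xy yz rooted_forestD(4)[OF F, of _ y] rooted_forestD(5)[OF F, of y]
  by (auto simp: siblings_def)

lemma siblings_root:
  assumes "rooted_forest F" "siblings F x y"
  shows "x \<in> roots F \<longleftrightarrow> y \<in> roots F"
  using assms rooted_forestD(5)[OF assms(1)] by (auto simp: siblings_def)

text \<open>If the common parent falls outside \<open>Y\<close>, both vertices become roots, since
  neither has another parent.\<close>

lemma siblings_induced:
  assumes F: "rooted_forest F" and xy: "siblings F x y" and Y: "x \<in> Y" "y \<in> Y"
  shows "siblings (induced F Y) x y"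
proof -
  note V = siblings_verts[OF F xy]
  from xy consider "x \<in> roots F" "y \<in> roots F" | p where "(p, x) \<in> edges F" "(p, y) \<in> edges F"
    by (auto simp: siblings_def)
  then show ?thesis
  proof cases
    case 1
    then show ?thesis using Y V rooted_forestD(5)[OF F] by (auto simp: siblings_def)
  next
    case 2
    show ?thesis
    proof (cases "p \<in> Y")
      case True
      then show ?thesis using 2 Y by (auto simp: siblings_def)
    next
      case False
      then have "\<forall>q\<in>Y. (q, x) \<notin> edges F \<and> (q, y) \<notin> edges F"
        using 2 rooted_forestD(4)[OF F] by blast
      then show ?thesis using V Y by (auto simp: siblings_def)
    qed
  qed
qed

text \<open>In general, cut-off parents leave new roots behind. With \<open>Y\<close> closed under
  parents, every root of the induced forest is an old root.\<close>

lemma siblings_induced_closed: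
  assumes F: "rooted_forest F" and xy: "siblings (induced F Y) x y"
    and cl: "\<And>p v. (p, v) \<in> edges F \<Longrightarrow> v \<in> Y \<Longrightarrow> p \<in> Y"
  shows "siblings F x y"
  using xy rooted_forestD(5)[OF F] cl by (auto simp: siblings_def)

lemma fraternal_verts:
  assumes "rooted_forest F" "fraternal F S"
  shows "S \<subseteq> verts F"
  using assms siblings_verts(1) by (fastforce simp: fraternal_def)

lemma fraternal_induced:
  assumes "rooted_forest F" "fraternal F S" "S \<subseteq> Y"
  shows "fraternal (induced F Y) S"
  using assms siblings_induced[OF assms(1)] by (auto simp: fraternal_def subset_iff)

lemma mfraternal_iff:
  "mfraternal F \<mu> S \<longleftrightarrow> S \<noteq> {} \<and> (\<forall>x\<in>S. \<forall>y\<in>S. siblings F x y \<and> siblings \<mu> x y)"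
  by (auto simp: mfraternal_def fraternal_def)

section \<open>Induction from the roots downwards, and the root above a vertex\<close>

lemma forest_top_down_induct [consumes 2, case_names root edge]:
  assumes F: "rooted_forest F" and v: "v \<in> verts F"
    and root: "\<And>r. r \<in> roots F \<Longrightarrow> P r"
    and edge: "\<And>p w. (p, w) \<in> edges F \<Longrightarrow> P p \<Longrightarrow> P w"
  shows "P v"
proof -
  have "finite (edges F)"
    using rooted_forestD(1,2)[OF F] finite_subset by blast
  then have "wf (edges F)"
    using rooted_forestD(3)[OF F] finite_acyclic_wf by blast
  then show ?thesis using v
  proof (induction v rule: wf_induct_rule)
    case (less v)
    show ?case
    proof (cases "v \<in> roots F")
      case True
      then show ?thesis by (rule root)
    next
      case False
      then obtain p where p: "(p, v) \<in> edges F"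
        using less.prems rooted_forestD(5)[OF F] by blast
      then show ?thesis using less.IH edge edge_verts[OF F p] by blast
    qed
  qed
qed

text \<open>The roots above a vertex with a parent are those above the parent, because that parent
  is unique and the vertex itself is no root.\<close>

lemma root_above_unique:
  assumes F: "rooted_forest F" and v: "v \<in> verts F"
  shows "\<exists>!r. r \<in> roots F \<and> (r, v) \<in> (edges F)\<^sup>*"
  using F v
proof (induction v rule: forest_top_down_induct)
  case (root r)
  then show ?case using rooted_forestD(5)[OF F] by (metis rtrancl.simps)
next
  case (edge p w)
  then have "r \<in> roots F \<and> (r, w) \<in> (edges F)\<^sup>* \<longleftrightarrow> r \<in> roots F \<and> (r, p) \<in> (edges F)\<^sup>*" for r
    using rooted_forestD(4,5)[OF F] by (metis rtrancl.simps)
  then show ?case using edge by simp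
qed

lemma ex_root_function:
  assumes F: "rooted_forest F"
  shows "\<exists>f. (\<forall>v\<in>verts F. f v \<in> roots F) \<and> (\<forall>v\<in>verts F. (f v, v) \<in> (edges F)\<^sup>*) \<and>
    (\<forall>v\<in>roots F. f v = v) \<and> (\<forall>x y. (x, y) \<in> edges F \<longrightarrow> f x = f y)"
proof -
  define f where "f v = (THE r. r \<in> roots F \<and> (r, v) \<in> (edges F)\<^sup>*)" for v
  have f: "f v \<in> roots F \<and> (f v, v) \<in> (edges F)\<^sup>*" if "v \<in> verts F" for v
    unfolding f_def using theI'[OF root_above_unique[OF F that]] .
  have f_eq: "f v = r" if "v \<in> verts F" "r \<in> roots F" "(r, v) \<in> (edges F)\<^sup>*" for v r
    using root_above_unique[OF F that(1)] f that by blast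
  have "f v = v" if "v \<in> roots F" for v
    using that f_eq rooted_forestD(5)[OF F] by blast
  moreover have "f x = f y" if "(x, y) \<in> edges F" for x y
    using that f[of x] f_eq[of y "f x"] edge_verts[OF F that]
    by (metis rtrancl.rtrancl_into_rtrancl)
  ultimately show ?thesis using f by blast
qed

section \<open>Splittable arenas\<close>

text \<open>\<open>Y\<close> and \<open>X - Y\<close> stand for a coarsening of a compatible
  partition to two blocks. A member of \<epsilon> whose set is \<open>X\<close> itself straddles
  every choice of \<open>Y\<close>; the strict inclusion exempts it.\<close>

definition splittable :: "'v set set \<Rightarrow> ('v set \<times> nat) forest \<Rightarrow> 'v set \<Rightarrow> bool" where
  "splittable \<alpha>2 \<epsilon> X \<longleftrightarrow>
     (\<exists>Y\<subseteq>X. Y \<noteq> {} \<and> Y \<noteq> X \<and>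
        ((\<forall>x\<in>Y. \<forall>y\<in>X - Y. {x, y} \<in> \<alpha>2) \<or> (\<forall>x\<in>Y. \<forall>y\<in>X - Y. {x, y} \<notin> \<alpha>2)) \<and>
        (\<forall>V\<in>verts \<epsilon>. fst V \<subset> X \<longrightarrow> fst V \<subseteq> Y \<or> fst V \<subseteq> X - Y))"

lemma splittable_mono:
  assumes "splittable \<alpha>2 \<epsilon> X" "verts \<epsilon>' \<subseteq> verts \<epsilon>"
  shows "splittable \<alpha>2 \<epsilon>' X"
proof -
  obtain Y where "Y \<subseteq> X" "Y \<noteq> {}" "Y \<noteq> X"
    "(\<forall>x\<in>Y. \<forall>y\<in>X - Y. {x, y} \<in> \<alpha>2) \<or> (\<forall>x\<in>Y. \<forall>y\<in>X - Y. {x, y} \<notin> \<alpha>2)"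
    and "\<forall>V\<in>verts \<epsilon>. fst V \<subset> X \<longrightarrow> fst V \<subseteq> Y \<or> fst V \<subseteq> X - Y"
    using assms(1) unfolding splittable_def by blast
  moreover from this have "\<forall>V\<in>verts \<epsilon>'. fst V \<subset> X \<longrightarrow> fst V \<subseteq> Y \<or> fst V \<subseteq> X - Y"
    using assms(2) by (meson subsetD)
  ultimately show ?thesis unfolding splittable_def by (intro exI[of _ Y]) simp
qed

text \<open>Unlike the recursive partitions of maximal sets, splittability of \<^emph>\<open>all\<close> fraternal sets passes
  to subarenas verbatim.\<close>

locale splittable_arena =
  fixes A :: "'v arena"
  assumes rooted_forest_frst: "rooted_forest (frst A)"
    and multiplicative_structure: "multiplicative_structure (frst A) (mult A)"
    and additive_structure: "additive_structure (frst A) (mult A) (add0 A) (add2 A)"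
    and exponential_structure: "exponential_structure (frst A) (mult A) (expo A)"
    and splittable: "mfraternal (frst A) (mult A) X \<Longrightarrow> \<not> is_singleton X \<Longrightarrow>
      splittable (add2 A) (expo A) X"

section \<open>Laminarity of the exponential structure\<close>

lemma exponential_structureD:
  assumes "exponential_structure F \<mu> \<epsilon>"
  shows "rooted_forest \<epsilon>" "V \<in> verts \<epsilon> \<Longrightarrow> mfraternal F \<mu> (fst V)" "inj_on snd (verts \<epsilon>)"
    and "(V, W) \<in> edges \<epsilon> \<Longrightarrow> fst W \<subseteq> fst V"
    and "siblings \<epsilon> V W \<Longrightarrow> V \<noteq> W \<Longrightarrow> fst V \<inter> fst W = {}"
  using assms unfolding exponential_structure_def by blast+

lemma exponential_rtrancl_subset:
  assumes "exponential_structure F \<mu> \<epsilon>" "(V, W) \<in> (edges \<epsilon>)\<^sup>*"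
  shows "fst W \<subseteq> fst V"
  using assms(2) by induction (use exponential_structureD(4)[OF assms(1)] in blast)+

text \<open>Distinct siblings carry disjoint sets and sets shrink downwards, so vertices on
  different branches are disjoint. The induction descends to \<open>V\<close> with \<open>W\<close>
  fixed; when \<open>W\<close> lies strictly below the parent of \<open>V\<close>, the child
  \<open>c\<close> through which it is reached is compared with \<open>V\<close>.\<close>

lemma exponential_comparable_or_disjoint:
  assumes E: "exponential_structure F \<mu> \<epsilon>" and V: "V \<in> verts \<epsilon>" and W: "W \<in> verts \<epsilon>"
  shows "(V, W) \<in> (edges \<epsilon>)\<^sup>* \<or> (W, V) \<in> (edges \<epsilon>)\<^sup>* \<or> fst V \<inter> fst W = {}"
  using exponential_structureD(1)[OF E] V
proof (induction V rule: forest_top_down_induct)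
  case (root V)
  obtain W0 where W0: "W0 \<in> roots \<epsilon>" "(W0, W) \<in> (edges \<epsilon>)\<^sup>*"
    using root_above_unique[OF exponential_structureD(1)[OF E] W] by blast
  show ?case
  proof (cases "V = W0")
    case False
    then have "fst V \<inter> fst W0 = {}"
      using root W0 exponential_structureD(5)[OF E] by (auto simp: siblings_def)
    then show ?thesis using exponential_rtrancl_subset[OF E W0(2)] by blast
  qed (use W0 in auto)
next
  case (edge p V)
  consider "(W, p) \<in> (edges \<epsilon>)\<^sup>*" | "fst p \<inter> fst W = {}"
    | c where "(p, c) \<in> edges \<epsilon>" "(c, W) \<in> (edges \<epsilon>)\<^sup>*"
    using edge.IH by (metis converse_rtranclE rtrancl.rtrancl_refl)
  then show ?case
  proof cases
    case 1
    then show ?thesis using edge by (meson rtrancl.rtrancl_into_rtrancl)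
  next
    case 2
    then show ?thesis using edge exponential_structureD(4)[OF E] by blast
  next
    case 3
    show ?thesis
    proof (cases "c = V")
      case False
      then have "fst V \<inter> fst c = {}"
        using edge.hyps 3(1) exponential_structureD(5)[OF E, of V c]
        unfolding siblings_def by blast
      then show ?thesis using exponential_rtrancl_subset[OF E 3(2)] by blast
    qed (use 3 in blast)
  qed
qed

lemma exponential_laminar:
  assumes E: "exponential_structure F \<mu> \<epsilon>" and "V \<in> verts \<epsilon>" "W \<in> verts \<epsilon>"
  shows "fst W \<subseteq> fst V \<or> fst V \<subseteq> fst W \<or> fst V \<inter> fst W = {}"
  using exponential_comparable_or_disjoint[OF assms] exponential_rtrancl_subset[OF E] by blast

section \<open>From recursive partitions to splittability\<close>

lemma splittable_if_compatible_partition: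
  assumes E: "exponential_structure F \<mu> \<epsilon>" and P: "partition_on N P" and X: "X \<subseteq> N" "X \<noteq> {}"
    and nosub: "\<And>M. M \<in> P \<Longrightarrow> \<not> X \<subseteq> M" and comp: "compatible_partition \<alpha>2 \<epsilon> P"
  shows "splittable \<alpha>2 \<epsilon> X"
proof -
  \<comment> \<open>The null-or-complete alternative for blocks becomes, by independence of
    representatives, all or none of the pairs of elements from distinct blocks.\<close>
  have cross: "(\<forall>M\<in>P. \<forall>M'\<in>P. M \<noteq> M' \<longrightarrow> (\<forall>x\<in>M. \<forall>y\<in>M'. {x, y} \<in> \<alpha>2)) \<or>
      (\<forall>M\<in>P. \<forall>M'\<in>P. M \<noteq> M' \<longrightarrow> (\<forall>x\<in>M. \<forall>y\<in>M'. {x, y} \<notin> \<alpha>2))"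
  proof -
    have indep: "{x, y} \<in> \<alpha>2 \<longleftrightarrow> {x', y'} \<in> \<alpha>2"
      if "M \<in> P" "M' \<in> P" "M \<noteq> M'" "x \<in> M" "x' \<in> M" "y \<in> M'" "y' \<in> M'" for M M' x x' y y'
    proof -
      have "\<forall>M\<in>P. \<forall>M'\<in>P. M \<noteq> M' \<longrightarrow>
          (\<forall>x\<in>M. \<forall>x'\<in>M. \<forall>y\<in>M'. \<forall>y'\<in>M'. {x, y} \<in> \<alpha>2 \<longleftrightarrow> {x', y'} \<in> \<alpha>2)"
        using comp unfolding compatible_partition_def by (elim conjE)
      then show ?thesis using that by meson
    qed
    have "(\<forall>M\<in>P. \<forall>M'\<in>P. M \<noteq> M' \<longrightarrow> \<not> part_adjacent \<alpha>2 M M') \<or>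
        (\<forall>M\<in>P. \<forall>M'\<in>P. M \<noteq> M' \<longrightarrow> part_adjacent \<alpha>2 M M')"
      using comp unfolding compatible_partition_def by (elim conjE)
    then show ?thesis
    proof
      assume "\<forall>M\<in>P. \<forall>M'\<in>P. M \<noteq> M' \<longrightarrow> \<not> part_adjacent \<alpha>2 M M'"
      then show ?thesis unfolding part_adjacent_def by blast
    next
      assume adj: "\<forall>M\<in>P. \<forall>M'\<in>P. M \<noteq> M' \<longrightarrow> part_adjacent \<alpha>2 M M'"
      have "{x, y} \<in> \<alpha>2" if M: "M \<in> P" "M' \<in> P" "M \<noteq> M'" "x \<in> M" "y \<in> M'" for M M' x y
      proof -
        obtain x' y' where "x' \<in> M" "y' \<in> M'" "{x', y'} \<in> \<alpha>2"
          using adj M unfolding part_adjacent_def by blast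
        then show ?thesis using indep[OF M(1-4) _ M(5)] by blast
      qed
      then show ?thesis by blast
    qed
  qed
  have expo: "fst V \<subseteq> M \<or> M \<subseteq> fst V" if "V \<in> verts \<epsilon>" "M \<in> P" "fst V \<inter> M \<noteq> {}" for V M
    using comp that unfolding compatible_partition_def by blast
  have part: "\<exists>M\<in>P. x \<in> M" if "x \<in> X" for x
    using that X P unfolding partition_on_def by blast
  have disj: "M \<inter> M' = {}" if "M \<in> P" "M' \<in> P" "M \<noteq> M'" for M M'
    using P that unfolding partition_on_def disjoint_def by blast
  \<comment> \<open>It suffices to cut \<open>X\<close> along blocks: \<open>sep\<close> says that
    \<open>Y\<close> contains the trace on \<open>X\<close> of every block that it meets, so an
    element of \<open>Y\<close> and one of \<open>X - Y\<close> lie in distinct blocks and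
    \<open>cross\<close> applies.\<close>
  have split: "splittable \<alpha>2 \<epsilon> X"
    if Y: "Y \<subseteq> X" "Y \<noteq> {}" "Y \<noteq> X"
      and sep: "\<And>M x y. M \<in> P \<Longrightarrow> x \<in> M \<Longrightarrow> x \<in> Y \<Longrightarrow> y \<in> M \<Longrightarrow> y \<in> X \<Longrightarrow> y \<in> Y"
      and V: "\<And>V. V \<in> verts \<epsilon> \<Longrightarrow> fst V \<subset> X \<Longrightarrow> fst V \<subseteq> Y \<or> fst V \<subseteq> X - Y" for Y
  proof -
    have diff: "\<exists>M\<in>P. \<exists>M'\<in>P. M \<noteq> M' \<and> x \<in> M \<and> y \<in> M'" if xy: "x \<in> Y" "y \<in> X - Y" for x y
    proof -
      obtain M M' where M: "M \<in> P" "x \<in> M" "M' \<in> P" "y \<in> M'"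
        using xy part[of x] part[of y] Y(1) by blast
      then have "M \<noteq> M'" using sep[of M x y] xy by blast
      then show ?thesis using M by blast
    qed
    from cross have "(\<forall>x\<in>Y. \<forall>y\<in>X - Y. {x, y} \<in> \<alpha>2) \<or> (\<forall>x\<in>Y. \<forall>y\<in>X - Y. {x, y} \<notin> \<alpha>2)"
      by (rule disj_forward) (use diff in fast)+
    then show ?thesis unfolding splittable_def using Y V by blast
  qed
  \<comment> \<open>The exponential sets strictly inside \<open>X\<close> that spread over several
    blocks decide the choice of \<open>Y\<close>.\<close>
  define bad where "bad = {V \<in> verts \<epsilon>. fst V \<subset> X \<and> \<not> (\<exists>M\<in>P. fst V \<subseteq> M)}"
  show ?thesis
  proof (cases "bad = {}")
    case True
    \<comment> \<open>Every exponential set strictly inside \<open>X\<close> stays within one block,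
      so the trace of any block meeting \<open>X\<close> can be split off. It is not all of
      \<open>X\<close> by \<open>nosub\<close>.\<close>
    obtain M where M: "M \<in> P" "X \<inter> M \<noteq> {}" using X part by blast
    show ?thesis
    proof (rule split[of "X \<inter> M"])
      show "X \<inter> M \<noteq> X" using nosub M by blast
      show "y \<in> X \<inter> M" if "M' \<in> P" "x \<in> M'" "x \<in> X \<inter> M" "y \<in> M'" "y \<in> X" for M' x y
        using that disj[OF M(1) that(1)] by blast
      show "fst V \<subseteq> X \<inter> M \<or> fst V \<subseteq> X - X \<inter> M" if V: "V \<in> verts \<epsilon>" "fst V \<subset> X" for V
      proof -
        obtain M' where "M' \<in> P" "fst V \<subseteq> M'" using V True unfolding bad_def by blast
        then show ?thesis using V(2) disj[OF M(1), of M'] by blast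
      qed
    qed (use M in auto)
  next
    case False
    have "finite (verts \<epsilon>)" using rooted_forestD(1) exponential_structureD(1)[OF E] by blast
    have fin: "finite (fst ` bad)" using \<open>finite (verts \<epsilon>)\<close> by (auto simp: bad_def)
    \<comment> \<open>\<open>Y\<close> is an inclusion-maximal bad set. By \<open>expo\<close> it
      absorbs every block that it meets, so it is a union of blocks. By laminarity only a strictly
      larger set inside \<open>X\<close> could straddle it, and such a set would be bad too, against
      maximality.\<close>
    obtain Y where "Y \<in> fst ` bad" and max: "\<And>Z. Z \<in> fst ` bad \<Longrightarrow> Y \<subseteq> Z \<Longrightarrow> Y = Z"
      using finite_has_maximal[OF fin] False by (metis image_is_empty)
    then obtain V where V: "V \<in> bad" "Y = fst V" by blast
    then have VE: "V \<in> verts \<epsilon>" "fst V \<subset> X" and Vno: "\<And>M. M \<in> P \<Longrightarrow> \<not> fst V \<subseteq> M"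
      by (auto simp: bad_def)
    show ?thesis
    proof (rule split[of Y])
      show "Y \<subseteq> X" "Y \<noteq> X" using V VE by auto
      show "Y \<noteq> {}" using V VE exponential_structureD(2)[OF E] by (auto simp: mfraternal_iff)
      show "y \<in> Y" if "M \<in> P" "x \<in> M" "x \<in> Y" "y \<in> M" "y \<in> X" for M x y
        using that expo[OF VE(1) that(1)] Vno[OF that(1)] V(2) by blast
      show "fst W \<subseteq> Y \<or> fst W \<subseteq> X - Y" if W: "W \<in> verts \<epsilon>" "fst W \<subset> X" for W
      proof -
        consider "fst W \<subseteq> Y" | "fst V \<inter> fst W = {}" | "fst V \<subseteq> fst W"
          using exponential_laminar[OF E VE(1) W(1)] V(2) by blast
        then show ?thesis
        proof cases
          case 3
          then have "W \<in> bad" using W Vno unfolding bad_def by blast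
          then show ?thesis using max[of "fst W"] 3 V(2) by blast
        qed (use W V in auto)
      qed
    qed
  qed
qed

text \<open>Being siblings in both forests is an equivalence relation on the vertices whose classes
  are maximal fraternal sets; \<open>S\<close> is the class of a point of \<open>X\<close>.\<close>

lemma ex_maximal_mfraternal:
  assumes F: "rooted_forest F" and \<mu>: "rooted_forest \<mu>" and X: "mfraternal F \<mu> X"
  shows "\<exists>S. X \<subseteq> S \<and> maximal_mfraternal F \<mu> S"
proof -
  obtain x where x: "x \<in> X" using X by (auto simp: mfraternal_iff)
  define S where "S = {y. siblings F x y \<and> siblings \<mu> x y}"
  have "X \<subseteq> S" using X x by (auto simp: mfraternal_iff S_def)
  moreover have "mfraternal F \<mu> S"
    unfolding mfraternal_iff
  proof (intro conjI ballI)
    show "S \<noteq> {}" using \<open>X \<subseteq> S\<close> x by blast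
    show "siblings F y z" if "y \<in> S" "z \<in> S" for y z
      using that siblings_trans[OF F siblings_sym, of x y z] by (simp add: S_def)
    show "siblings \<mu> y z" if "y \<in> S" "z \<in> S" for y z
      using that siblings_trans[OF \<mu> siblings_sym, of x y z] by (simp add: S_def)
  qed
  moreover have "S' \<subseteq> S" if "mfraternal F \<mu> S'" "S \<subseteq> S'" for S'
    using that \<open>X \<subseteq> S\<close> x by (auto simp: mfraternal_iff S_def)
  ultimately show ?thesis unfolding maximal_mfraternal_def by blast
qed

text \<open>In the recursive partition of the maximal set around \<open>X\<close>, a minimal node
  that still contains \<open>X\<close> is the place where \<open>X\<close> is broken up.\<close>

lemma combinatorial_arena_imp_splittable:
  assumes "combinatorial_arena A"
  shows "splittable_arena A"
proof -
  let ?F = "frst A" and ?\<mu> = "mult A"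
  have F: "rooted_forest ?F" and m: "multiplicative_structure ?F ?\<mu>"
    and a: "additive_structure ?F ?\<mu> (add0 A) (add2 A)"
    and E: "exponential_structure ?F ?\<mu> (expo A)"
    using assms unfolding combinatorial_arena_def by blast+
  have \<mu>: "rooted_forest ?\<mu>" using m unfolding multiplicative_structure_def by blast
  have "splittable (add2 A) (expo A) X" if X: "mfraternal ?F ?\<mu> X" "\<not> is_singleton X" for X
  proof -
    obtain S where S: "X \<subseteq> S" "maximal_mfraternal ?F ?\<mu> S"
      using ex_maximal_mfraternal[OF F \<mu> X(1)] by blast
    obtain T where T: "exhaustive_recursive_partition S T"
      and comp: "\<And>N. N \<in> verts T \<Longrightarrow> \<not> leaf T N \<Longrightarrow>
        compatible_partition (add2 A) (expo A) (children T N)"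
      using assms S unfolding combinatorial_arena_def by blast
    have rT: "rooted_forest T" and "roots T = {S}"
      and leafT: "\<And>N. N \<in> verts T \<Longrightarrow> leaf T N \<Longrightarrow> is_singleton N"
      and partT: "\<And>N. N \<in> verts T \<Longrightarrow> \<not> leaf T N \<Longrightarrow> partition_on N (children T N) \<and> card (children T N) > 1"
      using T unfolding exhaustive_recursive_partition_def by (auto split: if_splits)
    then have "S \<in> verts T" using rooted_forestD(5)[OF rT] by blast
    let ?\<N> = "{N \<in> verts T. X \<subseteq> N}"
    have "finite ?\<N>" "?\<N> \<noteq> {}" using rooted_forestD(1)[OF rT] \<open>S \<in> verts T\<close> S by auto
    then have "\<exists>N\<in>?\<N>. \<forall>M\<in>?\<N>. M \<subseteq> N \<longrightarrow> N = M" by (rule finite_has_minimal)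
    then obtain N where N: "N \<in> verts T" "X \<subseteq> N" and min: "\<forall>M\<in>?\<N>. M \<subseteq> N \<longrightarrow> N = M"
      by blast
    have X0: "X \<noteq> {}" using X by (auto simp: mfraternal_iff)
    have nl: "\<not> leaf T N"
      using leafT[OF N(1)] N(2) X(2) X0 by (auto simp: is_singleton_def subset_singleton_iff)
    have "\<not> X \<subseteq> M" if M: "M \<in> children T N" for M
    proof
      assume "X \<subseteq> M"
      have "M \<in> verts T" using M edge_verts[OF rT] by (auto simp: children_def)
      moreover have "M \<subseteq> N" using partT[OF N(1) nl] M by (auto simp: partition_on_def)
      \<comment> \<open>A child containing \<open>X\<close> would equal \<open>N\<close> by
        minimality, giving a loop in the tree.\<close>
      ultimately have "(N, N) \<in> edges T" using min \<open>X \<subseteq> M\<close> M by (auto simp: children_def)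
      then show False using rooted_forestD(3)[OF rT] by (auto simp: acyclic_def)
    qed
    then show ?thesis
      using splittable_if_compatible_partition[OF E _ N(2) X0 _ comp[OF N(1) nl]] partT[OF N(1) nl]
      by blast
  qed
  then show ?thesis using F m a E unfolding splittable_arena_def by blast
qed

section \<open>Restriction to a set of vertices\<close>

definition restrict_arena :: "'v arena \<Rightarrow> 'v set \<Rightarrow> 'v arena" where
  "restrict_arena A D =
     \<lparr>frst = induced (frst A) D, mult = induced (mult A) D, add0 = add0 A \<inter> D,
      add2 = add2 A \<inter> Pow D, expo = induced (expo A) (Pow D \<times> UNIV)\<rparr>"

context splittable_arena
begin

abbreviation "F \<equiv> frst A"
abbreviation "\<mu> \<equiv> mult A"
abbreviation "\<epsilon> \<equiv> expo A"
abbreviation "R \<equiv> common_roots A"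

section \<open>Common roots and the projection onto them\<close>

lemma structures:
  "rooted_forest F" "rooted_forest \<mu>" "verts \<mu> = verts F"
  "multiplicative_structure F \<mu>" "additive_structure F \<mu> (add0 A) (add2 A)"
  "exponential_structure F \<mu> \<epsilon>" "rooted_forest \<epsilon>"
  using rooted_forest_frst multiplicative_structure additive_structure exponential_structure
    exponential_structureD(1)
  unfolding multiplicative_structure_def by blast+

text \<open>A \<mu>-edge is a path with two vertices, and its vertex set must be fraternal in
  \<open>F\<close>.\<close>

lemma mult_edge_siblings:
  assumes "(x, y) \<in> edges \<mu>"
  shows "siblings F x y"
proof -
  have "path \<mu> [x, y]" using assms edge_verts[OF structures(2) assms] by (auto simp: path_def)
  then have "fraternal F (set [x, y])"
    using structures(4) unfolding multiplicative_structure_def by blast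
  then show ?thesis by (auto simp: fraternal_def)
qed

lemma mfraternal_verts: "mfraternal F \<mu> S \<Longrightarrow> S \<subseteq> verts F"
  using fraternal_verts[OF structures(1)] by (simp add: mfraternal_def)

lemma expo_mfraternal: "V \<in> verts \<epsilon> \<Longrightarrow> mfraternal F \<mu> (fst V)"
  using exponential_structureD(2)[OF structures(6)] .

lemma expo_nonempty: "V \<in> verts \<epsilon> \<Longrightarrow> fst V \<noteq> {}"
  using expo_mfraternal by (simp add: mfraternal_iff)

lemma add2E:
  assumes "e \<in> add2 A"
  obtains x y where "e = {x, y}" "x \<noteq> y" "mfraternal F \<mu> {x, y}"
  using assms structures(5) unfolding additive_structure_def by blast

lemma common_rootsD: "r \<in> R \<Longrightarrow> r \<in> roots F \<and> r \<in> roots \<mu> \<and> r \<in> verts F"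
  using rooted_forestD(5)[OF structures(1)] by (auto simp: common_roots_def)

text \<open>Siblings of roots are roots, so a set whose elements are siblings in both forests cannot
  leave \<open>R\<close>.\<close>

lemma mfraternal_meets_common_roots:
  assumes "mfraternal F \<mu> S" "S \<inter> R \<noteq> {}"
  shows "S \<subseteq> R"
proof
  fix y assume "y \<in> S"
  obtain x where "x \<in> S" "x \<in> R" using assms(2) by blast
  then have "siblings F x y" "siblings \<mu> x y" using assms(1) \<open>y \<in> S\<close> by (auto simp: mfraternal_iff)
  then show "y \<in> R"
    using \<open>x \<in> R\<close> siblings_root[OF structures(1)] siblings_root[OF structures(2)]
    by (auto simp: common_roots_def)
qed

lemma mfraternal_common_roots: "R \<noteq> {} \<Longrightarrow> mfraternal F \<mu> R"
  by (auto simp: mfraternal_iff common_roots_def siblings_def)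

lemma mult_ancestor_of_root:
  assumes "(x, y) \<in> (edges \<mu>)\<^sup>*" "y \<in> roots F"
  shows "x \<in> roots F"
  using assms siblings_root[OF structures(1) mult_edge_siblings]
  by (induction rule: converse_rtrancl_induct) auto

text \<open>The representative of \<open>v\<close> is the \<mu>-root above the \<open>F\<close>-root
  above \<open>v\<close>. An edge of \<open>F\<close> keeps the \<open>F\<close>-root. An edge of
  \<mu> joins siblings of \<open>F\<close>, which either have a common parent and hence the same
  \<open>F\<close>-root, or are \<open>F\<close>-roots themselves and have the same
  \<mu>-root.\<close>

lemma ex_representative:
  "\<exists>rep. (\<forall>v\<in>verts F. rep v \<in> R) \<and> (\<forall>v\<in>R. rep v = v) \<and>
    (\<forall>x y. (x, y) \<in> edges F \<or> (x, y) \<in> edges \<mu> \<longrightarrow> rep x = rep y)"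
proof -
  obtain f where f_all: "\<forall>v\<in>verts F. f v \<in> roots F" "\<forall>v\<in>roots F. f v = v"
    "\<forall>x y. (x, y) \<in> edges F \<longrightarrow> f x = f y"
    using ex_root_function[OF structures(1)] by blast
  note f = f_all[rule_format]
  obtain m where m_all: "\<forall>v\<in>verts F. m v \<in> roots \<mu>" "\<forall>v\<in>verts F. (m v, v) \<in> (edges \<mu>)\<^sup>*"
    "\<forall>v\<in>roots \<mu>. m v = v" "\<forall>x y. (x, y) \<in> edges \<mu> \<longrightarrow> m x = m y"
    using ex_root_function[OF structures(2)] unfolding structures(3) by blast
  note m = m_all[rule_format]
  have rv: "v \<in> verts F" if "v \<in> roots F" for v
    using that rooted_forestD(5)[OF structures(1)] by blast
  show ?thesis
  proof (intro exI[of _ "m \<circ> f"] conjI ballI allI impI)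
    \<comment> \<open>Since \<mu>-edges join siblings of \<open>F\<close>, the \<mu>-root above an
      \<open>F\<close>-root is again an \<open>F\<close>-root.\<close>
    show "(m \<circ> f) v \<in> R" if "v \<in> verts F" for v
      using f(1)[OF that] m(1,2)[of "f v"] rv mult_ancestor_of_root[of "m (f v)" "f v"] by (simp add: common_roots_def)
    show "(m \<circ> f) v = v" if "v \<in> R" for v
      using that f m by (simp add: common_roots_def)
    show "(m \<circ> f) x = (m \<circ> f) y" if "(x, y) \<in> edges F \<or> (x, y) \<in> edges \<mu>" for x y
    proof (cases "(x, y) \<in> edges F")
      case False
      then have xy: "(x, y) \<in> edges \<mu>" using that by blast
      from mult_edge_siblings[OF xy] show ?thesis
        unfolding siblings_def
      proof (elim disjE exE conjE)
        fix p assume "(p, x) \<in> edges F" "(p, y) \<in> edges F"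
        then have "f x = f y" using f(3)[of p x] f(3)[of p y] by simp
        then show ?thesis by simp
      qed (use f(2) m(4)[OF xy] in simp)
    qed (use f in auto)
  qed
qed

lemma common_roots_nonempty: "verts F \<noteq> {} \<Longrightarrow> R \<noteq> {}"
  using ex_representative by blast

section \<open>Restrictions as splittable arenas, and reassembling them\<close>

lemma splittable_arena_restrict:
  assumes sib: "\<And>x y. siblings (induced F D) x y \<Longrightarrow> siblings (induced \<mu> D) x y \<Longrightarrow>
      siblings F x y \<and> siblings \<mu> x y"
    and expo: "\<And>V. V \<in> verts \<epsilon> \<Longrightarrow> fst V \<inter> D \<noteq> {} \<Longrightarrow> fst V \<subseteq> D"
  shows "splittable_arena (restrict_arena A D)"
proof -
  let ?F = "induced F D" and ?\<mu> = "induced \<mu> D" and ?\<epsilon> = "induced \<epsilon> (Pow D \<times> UNIV)"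
  have rF: "rooted_forest ?F" and r\<mu>: "rooted_forest ?\<mu>"
    using structures rooted_forest_induced by blast+
  have mf: "mfraternal ?F ?\<mu> S" if "mfraternal F \<mu> S" "S \<subseteq> D" for S
    using that fraternal_induced structures(1,2) unfolding mfraternal_def by blast
  \<comment> \<open>Cutting off parents could turn unrelated vertices into siblings and create
    fraternal sets about which \<open>splittable\<close> says nothing. \<open>sib\<close> excludes
    this for both relations jointly, because in the conclusion of a linear implication \<mu> alone
    may gain siblings.\<close>
  have fm: "mfraternal F \<mu> S \<and> S \<subseteq> D" if "mfraternal ?F ?\<mu> S" for S
    using that sib fraternal_verts[OF rF, of S] unfolding mfraternal_iff fraternal_def by auto
  have "multiplicative_structure ?F ?\<mu>"
    unfolding multiplicative_structure_def
  proof (intro conjI allI impI)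
    fix xs assume xs: "path ?\<mu> xs \<and> xs \<noteq> []"
    then have "path \<mu> xs" "set xs \<subseteq> D"
      by (auto simp: path_def elim: successively_mono)
    then show "fraternal ?F (set xs)"
      using xs structures(1,4) fraternal_induced unfolding multiplicative_structure_def by blast
  qed (use r\<mu> structures(3) in auto)
  moreover have "additive_structure ?F ?\<mu> (add0 A \<inter> D) (add2 A \<inter> Pow D)"
    unfolding additive_structure_def
  proof
    show "add0 A \<inter> D \<subseteq> {v. leaf ?F v \<and> \<not> switching ?\<mu> v}"
      using structures(5)
      by (auto simp: additive_structure_def leaf_def switching_def children_def)
    show "add2 A \<inter> Pow D \<subseteq> {{x, y} |x y. x \<noteq> y \<and> mfraternal ?F ?\<mu> {x, y}}"
    proof
      fix e assume e: "e \<in> add2 A \<inter> Pow D"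
      then obtain x y where "e = {x, y}" "x \<noteq> y" "mfraternal F \<mu> {x, y}" using add2E by blast
      then show "e \<in> {{x, y} |x y. x \<noteq> y \<and> mfraternal ?F ?\<mu> {x, y}}" using mf e by blast
    qed
  qed
  moreover have "exponential_structure ?F ?\<mu> ?\<epsilon>"
  proof -
    \<comment> \<open>A parent in \<epsilon> has the larger set, so it meets \<open>D\<close> when
      its child lies in \<open>D\<close>, and then lies in \<open>D\<close> by \<open>expo\<close>.
      Hence no new roots of \<epsilon> arise.\<close>
    have "siblings \<epsilon> V W" if "siblings ?\<epsilon> V W" for V W
    proof (rule siblings_induced_closed[OF structures(7) that])
      fix p v assume pv: "(p, v) \<in> edges \<epsilon>" "v \<in> Pow D \<times> (UNIV :: nat set)"
      then have "p \<in> verts \<epsilon>" "v \<in> verts \<epsilon>" "fst v \<subseteq> fst p"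
        using edge_verts[OF structures(7)] exponential_structureD(4)[OF structures(6)] by blast+
      then show "p \<in> Pow D \<times> UNIV"
        using expo[of p] expo_nonempty[of v] pv(2) by (cases p, cases v) fastforce
    qed
    then show ?thesis
      using exponential_structureD[OF structures(6)] rooted_forest_induced[OF structures(7)] mf
      unfolding exponential_structure_def by (auto intro: inj_on_subset)
  qed
  moreover have "splittable (add2 A \<inter> Pow D) ?\<epsilon> X" if X: "mfraternal ?F ?\<mu> X" "\<not> is_singleton X" for X
  proof -
    have XD: "X \<subseteq> D" and "splittable (add2 A) \<epsilon> X" using fm[OF X(1)] splittable X(2) by blast+
    then obtain Y where Y: "Y \<subseteq> X" "Y \<noteq> {}" "Y \<noteq> X"
      "(\<forall>x\<in>Y. \<forall>y\<in>X - Y. {x, y} \<in> add2 A) \<or> (\<forall>x\<in>Y. \<forall>y\<in>X - Y. {x, y} \<notin> add2 A)"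
      "\<forall>V\<in>verts \<epsilon>. fst V \<subset> X \<longrightarrow> fst V \<subseteq> Y \<or> fst V \<subseteq> X - Y"
      unfolding splittable_def by blast
    have "(\<forall>x\<in>Y. \<forall>y\<in>X - Y. {x, y} \<in> add2 A \<inter> Pow D) \<or> (\<forall>x\<in>Y. \<forall>y\<in>X - Y. {x, y} \<notin> add2 A \<inter> Pow D)"
      using Y(1,4) XD by blast
    then show ?thesis unfolding splittable_def using Y by (intro exI[of _ Y]) auto
  qed
  ultimately show ?thesis
    unfolding splittable_arena_def restrict_arena_def using rF by simp
qed

text \<open>Restriction keeps the numbers, and these identify the vertices of \<epsilon>. A common
  number would belong to a set contained in both \<open>D\<close> and \<open>E\<close>, yet
  exponential sets are nonempty.\<close>

lemma disjoint_arenas_restrict: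
  assumes "D \<inter> E = {}"
  shows "disjoint_arenas (restrict_arena A D) (restrict_arena A E)"
proof -
  have "snd V \<noteq> snd W" if "V \<in> verts \<epsilon>" "fst V \<subseteq> D" "W \<in> verts \<epsilon>" "fst W \<subseteq> E" for V W
  proof
    assume "snd V = snd W"
    then have "V = W" using that exponential_structureD(3)[OF structures(6)] by (auto dest: inj_onD)
    then show False using that expo_nonempty assms by blast
  qed
  then have "snd ` (verts \<epsilon> \<inter> Pow D \<times> UNIV) \<inter> snd ` (verts \<epsilon> \<inter> Pow E \<times> UNIV) = {}"
    by force
  then show ?thesis using assms by (auto simp: disjoint_arenas_def restrict_arena_def)
qed

text \<open>A child carries a nonempty subset of its parent's set, so both lie on the same side: no
  edge is lost and no new root appears.\<close>

lemma expo_union_restrict: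
  assumes "\<And>V. V \<in> verts \<epsilon> \<Longrightarrow> fst V \<subseteq> D \<or> fst V \<subseteq> E" "D \<inter> E = {}"
  shows "induced \<epsilon> (Pow D \<times> UNIV) \<uplus>\<^sub>F induced \<epsilon> (Pow E \<times> UNIV) = \<epsilon>"
proof -
  have e: "(fst V \<subseteq> D \<and> fst W \<subseteq> D) \<or> (fst V \<subseteq> E \<and> fst W \<subseteq> E)" if "(V, W) \<in> edges \<epsilon>" for V W
    using assms(1)[OF edge_verts(1)[OF structures(7) that]]
      exponential_structureD(4)[OF structures(6) that] by blast
  have ne: "fst V \<noteq> {}" if "V \<in> verts \<epsilon>" for V using expo_nonempty[OF that] .
  show ?thesis
  proof (rule forest_eqI)
    show "verts (induced \<epsilon> (Pow D \<times> UNIV) \<uplus>\<^sub>F induced \<epsilon> (Pow E \<times> UNIV)) = verts \<epsilon>"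
      using assms(1) by fastforce
    show "edges (induced \<epsilon> (Pow D \<times> UNIV) \<uplus>\<^sub>F induced \<epsilon> (Pow E \<times> UNIV)) = edges \<epsilon>"
      using e by fastforce
    have "p \<in> Pow C \<times> UNIV" if "(p, v) \<in> edges \<epsilon>" "v \<in> Pow C \<times> UNIV" "C = D \<or> C = E" for p v C
    proof -
      have "fst v \<noteq> {}" using ne edge_verts(2)[OF structures(7) that(1)] by blast
      then have "fst p \<subseteq> C" using e[OF that(1)] that(2,3) assms(2) by (cases v) auto
      then show ?thesis by (cases p) auto
    qed
    then have "roots (induced \<epsilon> (Pow D \<times> UNIV) \<uplus>\<^sub>F induced \<epsilon> (Pow E \<times> UNIV)) =
        {v \<in> verts \<epsilon> \<inter> (Pow D \<times> UNIV \<union> Pow E \<times> UNIV). \<forall>p. (p, v) \<notin> edges \<epsilon>}"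
      by (simp only: forest_union_simps induced_simps) blast
    also have "\<dots> = roots \<epsilon>"
      using assms(1) rooted_forestD(5)[OF structures(7)] by fastforce
    finally show "roots (induced \<epsilon> (Pow D \<times> UNIV) \<uplus>\<^sub>F induced \<epsilon> (Pow E \<times> UNIV)) = roots \<epsilon>" .
  qed
qed

section \<open>Decomposition of splittable arenas\<close>

lemma expo_common_roots_dichotomy:
  assumes "V \<in> verts \<epsilon>"
  shows "fst V \<subseteq> R \<or> fst V \<subseteq> verts F - R"
  using mfraternal_meets_common_roots[OF expo_mfraternal[OF assms]]
    mfraternal_verts[OF expo_mfraternal[OF assms]] by blast

text \<open>The root \<open>V0\<close> of \<epsilon> above \<open>V\<close> carries a set containing
  \<open>R\<close>, hence \<open>R\<close> itself. Deleting this one vertex promotes its children to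
  roots, and of-course with the number of \<open>V0\<close> puts it back.\<close>

lemma ofcourse_decomposition:
  assumes V: "V \<in> verts \<epsilon>" "fst V = R"
  obtains A' i where "splittable_arena A'" "A = ofcourse_arena i A'" "common_roots A' \<noteq> {}"
    "i \<notin> snd ` verts (expo A')" "verts (frst A') = verts F" "card (verts (expo A')) < card (verts \<epsilon>)"
proof -
  note \<epsilon> = structures(7) and E = structures(6)
  obtain V0 where V0: "V0 \<in> roots \<epsilon>" "(V0, V) \<in> (edges \<epsilon>)\<^sup>*"
    using root_above_unique[OF \<epsilon> V(1)] by blast
  then have V0v: "V0 \<in> verts \<epsilon>" using rooted_forestD(5)[OF \<epsilon>] by blast
  have R0: "R \<noteq> {}" using expo_nonempty[OF V(1)] V(2) by simp
  have "R \<subseteq> fst V0" using exponential_rtrancl_subset[OF E V0(2)] V(2) by simp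
  then have V0R: "fst V0 = R"
    using mfraternal_meets_common_roots[OF expo_mfraternal[OF V0v]] R0 by blast
  define i where "i = snd V0"
  have V0_eq: "V0 = (R, i)" using V0R by (simp add: i_def prod_eq_iff)
  \<comment> \<open>Distinct roots carry disjoint sets, so every other root of \<epsilon> stays off
    \<open>R\<close>.\<close>
  have root_eq: "W = V0" if "W \<in> roots \<epsilon>" "fst W \<subseteq> R" for W
  proof (rule ccontr)
    assume "W \<noteq> V0"
    then have "fst W \<inter> fst V0 = {}"
      using exponential_structureD(5)[OF E, of W V0] that V0 by (auto simp: siblings_def)
    moreover have "fst W \<noteq> {}" using that rooted_forestD(5)[OF \<epsilon>] expo_nonempty by blast
    ultimately show False using that V0R by blast
  qed
  define \<epsilon>' where "\<epsilon>' = induced \<epsilon> (- {V0})"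
  define A' where "A' = A\<lparr>expo := \<epsilon>'\<rparr>"
  have R': "common_roots A' = R" by (simp add: A'_def common_roots_def)
  have noV0: "(p, V0) \<notin> edges \<epsilon>" for p using V0 rooted_forestD(5)[OF \<epsilon>] by blast
  have r\<epsilon>': "rooted_forest \<epsilon>'" unfolding \<epsilon>'_def using rooted_forest_induced[OF \<epsilon>] .
  have roots': "W \<in> roots \<epsilon>' \<longleftrightarrow> (V0, W) \<in> edges \<epsilon> \<or> (W \<in> roots \<epsilon> \<and> W \<noteq> V0)" for W
    using rooted_forestD(4,5)[OF \<epsilon>] edge_verts[OF \<epsilon>] noV0 unfolding \<epsilon>'_def
    by (auto; metis)
  have sub_edge: "fst W \<subseteq> fst U" if "(U, W) \<in> edges \<epsilon>" for U W
    using exponential_structureD(4)[OF E that] .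
  have "exponential_structure F \<mu> \<epsilon>'"
  proof -
    \<comment> \<open>The only new pairs of siblings consist of a child of \<open>V0\<close> and
      another old root. The child's set lies in \<open>R\<close>, off the set of that root.\<close>
    have "fst U \<inter> fst W = {}" if UW: "siblings \<epsilon>' U W" "U \<noteq> W" for U W
    proof -
      have dis: "fst U \<inter> fst W = {}"
        if "(V0, U) \<in> edges \<epsilon>" "W \<in> roots \<epsilon>" "W \<noteq> V0" for U W
        using exponential_structureD(5)[OF E, of V0 W] that V0 sub_edge[OF that(1)]
        by (auto simp: siblings_def)
      consider "siblings \<epsilon> U W" | "(V0, U) \<in> edges \<epsilon>" "W \<in> roots \<epsilon>" "W \<noteq> V0"
        | "(V0, W) \<in> edges \<epsilon>" "U \<in> roots \<epsilon>" "U \<noteq> V0"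
        using UW(1) unfolding siblings_def roots' by (auto simp: \<epsilon>'_def simp del: split_paired_Ex)
      then show ?thesis
        using exponential_structureD(5)[OF E, of U W] UW(2) dis[of U W] dis[of W U] by cases auto
    qed
    then show ?thesis
      using E r\<epsilon>' unfolding exponential_structure_def
      by (auto simp: \<epsilon>'_def simp del: split_paired_All intro: inj_on_subset)
  qed
  moreover have "splittable (add2 A) \<epsilon>' X" if "splittable (add2 A) \<epsilon> X" for X
    using splittable_mono[OF that] by (simp add: \<epsilon>'_def)
  ultimately have 1: "splittable_arena A'"
    using structures splittable unfolding splittable_arena_def A'_def by simp
  \<comment> \<open>Sets shrink downwards, so the vertices inside \<open>R\<close> are already
    closed under descendants and \<open>subforest_below\<close> reduces to an induced
    subforest.\<close>
  have below: "(edges \<epsilon>')\<^sup>* `` (Pow R \<times> UNIV \<inter> verts \<epsilon>') = Pow R \<times> UNIV \<inter> verts \<epsilon>'" (is "_ `` ?B = _")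
  proof
    have "W \<in> ?B" if "(U, W) \<in> (edges \<epsilon>')\<^sup>*" "U \<in> ?B" for U W
      using that
    proof induction
      case (step y z)
      then have "(y, z) \<in> edges \<epsilon>" "z \<in> verts \<epsilon>'" "fst y \<subseteq> R"
        using edge_verts(2)[OF r\<epsilon>', of y z] by (auto simp: \<epsilon>'_def simp del: split_paired_All)
      then show ?case using sub_edge[of y z] by (cases z) auto
    qed
    then show "(edges \<epsilon>')\<^sup>* `` ?B \<subseteq> ?B" by blast
  qed auto
  let ?G = "induced \<epsilon>' (Pow R \<times> UNIV \<inter> verts \<epsilon>')"
  let ?H = "induced \<epsilon>' (Pow (verts F - R) \<times> UNIV)"
  \<comment> \<open>Edges of \<epsilon> never cross between \<open>R\<close> and its complement, so
    the two parts of the of-course are not linked.\<close>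
  have side: "fst U \<subseteq> R \<longleftrightarrow> fst W \<subseteq> R" "fst U \<subseteq> verts F - R \<longleftrightarrow> fst W \<subseteq> verts F - R"
    if UW: "(U, W) \<in> edges \<epsilon>" for U W
    using expo_common_roots_dichotomy[OF edge_verts(1)[OF \<epsilon> UW]]
      expo_common_roots_dichotomy[OF edge_verts(2)[OF \<epsilon> UW]] sub_edge[OF UW]
      expo_nonempty[OF edge_verts(2)[OF \<epsilon> UW]] by blast+
  have memB: "W \<in> Pow X \<times> UNIV \<longleftrightarrow> fst W \<subseteq> X" for W :: "'v set \<times> nat" and X by (cases W) auto
  \<comment> \<open>Exactly the children of \<open>V0\<close> become the roots inside
    \<open>R\<close>, so \<open>add_root\<close> recreates precisely the deleted edges.\<close>
  have rG: "W \<in> roots ?G \<longleftrightarrow> (V0, W) \<in> edges \<epsilon>" for W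
  proof
    assume W: "W \<in> roots ?G"
    then have W': "W \<in> verts \<epsilon>" "fst W \<subseteq> R" "W \<noteq> V0" by (auto simp: \<epsilon>'_def memB)
    then have "W \<notin> roots \<epsilon>" using root_eq by blast
    then obtain p where p: "(p, W) \<in> edges \<epsilon>" using W' rooted_forestD(5)[OF \<epsilon>] by blast
    have "p = V0"
    proof (rule ccontr)
      assume "p \<noteq> V0"
      then have "p \<in> Pow R \<times> UNIV \<inter> verts \<epsilon>'" "(p, W) \<in> edges \<epsilon>'"
        using p side(1)[OF p] W' edge_verts[OF \<epsilon> p] by (auto simp: \<epsilon>'_def memB)
      then show False using W by auto
    qed
    then show "(V0, W) \<in> edges \<epsilon>" using p by simp
  next
    assume W: "(V0, W) \<in> edges \<epsilon>"
    then have "W \<noteq> V0" using noV0 by metis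
    then have "W \<in> verts \<epsilon>'" "fst W \<subseteq> R"
      using edge_verts[OF \<epsilon> W] sub_edge[OF W] V0R by (auto simp: \<epsilon>'_def)
    moreover have "(p, W) \<notin> edges \<epsilon>'" for p
      using W rooted_forestD(4)[OF \<epsilon>] by (auto simp: \<epsilon>'_def)
    ultimately show "W \<in> roots ?G" by (auto simp: memB)
  qed
  have rH: "W \<in> roots ?H \<longleftrightarrow> W \<in> roots \<epsilon> \<and> W \<noteq> V0" for W
  proof
    assume W: "W \<in> roots ?H"
    then have W': "W \<in> verts \<epsilon>" "fst W \<subseteq> verts F - R" "W \<noteq> V0" by (auto simp: \<epsilon>'_def memB)
    have "(p, W) \<notin> edges \<epsilon>" for p
    proof
      assume p: "(p, W) \<in> edges \<epsilon>"
      then have "fst p \<subseteq> verts F - R" using side(2) W' by blast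
      moreover from this have "p \<noteq> V0" using V0R R0 by blast
      ultimately have "p \<in> Pow (verts F - R) \<times> UNIV" "(p, W) \<in> edges \<epsilon>'"
        using p W' unfolding memB \<epsilon>'_def by auto
      then show False using W unfolding induced_simps by blast
    qed
    then show "W \<in> roots \<epsilon> \<and> W \<noteq> V0" using W' rooted_forestD(5)[OF \<epsilon>] by blast
  next
    assume W: "W \<in> roots \<epsilon> \<and> W \<noteq> V0"
    then have "W \<in> verts \<epsilon>" "\<And>p. (p, W) \<notin> edges \<epsilon>" using rooted_forestD(5)[OF \<epsilon>] by blast+
    then show "W \<in> roots ?H"
      using W root_eq[of W] expo_common_roots_dichotomy[of W] by (auto simp: \<epsilon>'_def memB)
  qed
  have "\<epsilon> = add_root (R, i) ?G \<uplus>\<^sub>F ?H"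
  proof (rule forest_eqI)
    show "verts \<epsilon> = verts (add_root (R, i) ?G \<uplus>\<^sub>F ?H)"
    proof (rule set_eqI)
      fix W
      show "W \<in> verts \<epsilon> \<longleftrightarrow> W \<in> verts (add_root (R, i) ?G \<uplus>\<^sub>F ?H)"
        using V0v expo_common_roots_dichotomy[of W]
        unfolding V0_eq[symmetric] by (auto simp: \<epsilon>'_def memB)
    qed
    have G: "(U, W) \<in> edges ?G \<longleftrightarrow> (U, W) \<in> edges \<epsilon> \<and> U \<noteq> V0 \<and> W \<noteq> V0 \<and> fst U \<subseteq> R \<and> fst W \<subseteq> R" for U W
      using edge_verts[OF \<epsilon>, of U W] by (auto simp: \<epsilon>'_def memB)
    have H: "(U, W) \<in> edges ?H \<longleftrightarrow> (U, W) \<in> edges \<epsilon> \<and> U \<noteq> V0 \<and> W \<noteq> V0 \<and>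
        fst U \<subseteq> verts F - R \<and> fst W \<subseteq> verts F - R" for U W
      by (auto simp: \<epsilon>'_def memB)
    have "(U, W) \<in> edges \<epsilon> \<longleftrightarrow> (U, W) \<in> {V0} \<times> roots ?G \<or> (U, W) \<in> edges ?G \<or> (U, W) \<in> edges ?H" for U W
    proof
      assume UW: "(U, W) \<in> edges \<epsilon>"
      have "W \<noteq> V0" using UW noV0 by metis
      moreover have "fst W \<subseteq> R \<or> fst W \<subseteq> verts F - R"
        using expo_common_roots_dichotomy edge_verts(2)[OF \<epsilon> UW] .
      ultimately show "(U, W) \<in> {V0} \<times> roots ?G \<or> (U, W) \<in> edges ?G \<or> (U, W) \<in> edges ?H"
        unfolding G H mem_Times_iff rG using UW side[OF UW] by (cases "U = V0") auto
    next
      assume "(U, W) \<in> {V0} \<times> roots ?G \<or> (U, W) \<in> edges ?G \<or> (U, W) \<in> edges ?H"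
      then show "(U, W) \<in> edges \<epsilon>" unfolding G H mem_Times_iff rG by auto
    qed
    then show "edges \<epsilon> = edges (add_root (R, i) ?G \<uplus>\<^sub>F ?H)"
      unfolding V0_eq[symmetric] forest_union_simps(2) add_root_simps(2) by (intro set_eqI) (metis Un_iff surj_pair)
    show "roots \<epsilon> = roots (add_root (R, i) ?G \<uplus>\<^sub>F ?H)"
      unfolding V0_eq[symmetric] forest_union_simps(3) add_root_simps(3) using rH V0 by blast
  qed
  then have 2: "A = ofcourse_arena i A'"
    unfolding ofcourse_arena_def Let_def R' subforest_below_def
    using below by (simp add: A'_def)
  have 3: "i \<notin> snd ` verts (expo A')"
    using exponential_structureD(3)[OF E] V0v
    by (auto simp: A'_def \<epsilon>'_def i_def inj_on_def)
  have "verts (expo A') \<subset> verts \<epsilon>" using V0v by (auto simp: A'_def \<epsilon>'_def)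
  then have "card (verts (expo A')) < card (verts \<epsilon>)"
    using rooted_forestD(1)[OF \<epsilon>] by (intro psubset_card_mono)
  moreover have "common_roots A' \<noteq> {}" unfolding R' by (rule R0)
  moreover have "verts (frst A') = verts F" unfolding A'_def by simp
  ultimately show ?thesis using that[OF 1 2 _ 3] by blast
qed

section \<open>Several common roots: tensor and with\<close>

lemma product_decomposition:
  assumes R: "R \<noteq> {}" "\<not> is_singleton R" and noR: "\<And>V. V \<in> verts \<epsilon> \<Longrightarrow> fst V \<noteq> R"
  obtains D E where "splittable_arena (restrict_arena A D)" "splittable_arena (restrict_arena A E)"
    "disjoint_arenas (restrict_arena A D) (restrict_arena A E)"
    "A = tensor_arena (restrict_arena A D) (restrict_arena A E) \<or>
     A = with_arena (restrict_arena A D) (restrict_arena A E)"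
    "D \<subset> verts F" "E \<subset> verts F"
proof -
  obtain rep where rep_all: "\<forall>v\<in>verts F. rep v \<in> R" "\<forall>v\<in>R. rep v = v"
    "\<forall>x y. (x, y) \<in> edges F \<or> (x, y) \<in> edges \<mu> \<longrightarrow> rep x = rep y"
    using ex_representative by blast
  note rep = rep_all[rule_format]
  obtain X where X: "X \<subseteq> R" "X \<noteq> {}" "X \<noteq> R"
    and cross: "(\<forall>x\<in>X. \<forall>y\<in>R - X. {x, y} \<in> add2 A) \<or> (\<forall>x\<in>X. \<forall>y\<in>R - X. {x, y} \<notin> add2 A)"
    and exp: "\<forall>V\<in>verts \<epsilon>. fst V \<subset> R \<longrightarrow> fst V \<subseteq> X \<or> fst V \<subseteq> R - X"
    using splittable[OF mfraternal_common_roots[OF R(1)] R(2)] unfolding splittable_def by blast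
  \<comment> \<open>The two blocks of \<open>R\<close> are pulled back along \<open>rep\<close>, so
    edges of neither \<open>F\<close> nor \<mu> run between \<open>D\<close> and
    \<open>E\<close>.\<close>
  define D where "D = {v \<in> verts F. rep v \<in> X}"
  define E where "E = {v \<in> verts F. rep v \<in> R - X}"
  have DE: "D \<union> E = verts F" "D \<inter> E = {}" using rep(1) by (auto simp: D_def E_def)
  have Rv: "R \<subseteq> verts F" using common_rootsD by blast
  have XDE: "R \<inter> D = X" "R \<inter> E = R - X" using rep(2) Rv X by (auto simp: D_def E_def)
  \<comment> \<open>Outside \<open>R\<close> at least one of the forests provides a common parent,
    and \<open>rep\<close> is constant along its edges.\<close>
  have same: "rep x = rep y" if xy: "siblings F x y" "siblings \<mu> x y" "x \<notin> R" for x y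
  proof -
    have "x \<notin> roots F \<or> x \<notin> roots \<mu>" using xy by (auto simp: common_roots_def)
    then obtain p where "((p, x) \<in> edges F \<and> (p, y) \<in> edges F) \<or> ((p, x) \<in> edges \<mu> \<and> (p, y) \<in> edges \<mu>)"
      using xy unfolding siblings_def by blast
    then show ?thesis using rep(3)[of p x] rep(3)[of p y] by auto
  qed
  have exp_side: "fst V \<subseteq> D \<or> fst V \<subseteq> E" if V: "V \<in> verts \<epsilon>" for V
  proof -
    note f = expo_mfraternal[OF V]
    show ?thesis
    proof (cases "fst V \<inter> R = {}")
      case False
      \<comment> \<open>The splitting of \<open>R\<close> speaks only of proper subsets;
        \<open>noR\<close> makes the inclusion strict.\<close>
      then have "fst V \<subset> R" using mfraternal_meets_common_roots[OF f] noR[OF V] by blast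
      then show ?thesis using exp V XDE by blast
    next
      case True
      then have "rep x = rep y" if "x \<in> fst V" "y \<in> fst V" for x y
        using that f same unfolding mfraternal_iff by blast
      moreover obtain x where x: "x \<in> fst V" using expo_nonempty[OF V] by blast
      ultimately have rep_V: "\<And>y. y \<in> fst V \<Longrightarrow> y \<in> verts F \<and> rep y = rep x"
        using mfraternal_verts[OF f] by blast
      then have "rep x \<in> R" using rep(1) x by blast
      then show ?thesis using rep_V by (cases "rep x \<in> X") (auto simp: D_def E_def)
    qed
  qed
  have edgeF: "x \<in> D \<longleftrightarrow> y \<in> D" "x \<in> E \<longleftrightarrow> y \<in> E"
    if "(x, y) \<in> edges F \<or> (x, y) \<in> edges \<mu>" for x y
    using rep(3)[OF that] that edge_verts[OF structures(1)] edge_verts[OF structures(2)] structures(3)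
    by (auto simp: D_def E_def)
  have spl: "splittable_arena (restrict_arena A C)" if C: "C = D \<or> C = E" for C
  proof (rule splittable_arena_restrict)
    show "siblings F x y \<and> siblings \<mu> x y"
      if "siblings (induced F C) x y" "siblings (induced \<mu> C) x y" for x y
      using siblings_induced_closed[OF structures(1) that(1)]
        siblings_induced_closed[OF structures(2) that(2)] edgeF C by blast
    show "fst V \<subseteq> C" if "V \<in> verts \<epsilon>" "fst V \<inter> C \<noteq> {}" for V
      using exp_side[OF that(1)] that(2) C DE(2) by blast
  qed
  have un: "induced G D \<uplus>\<^sub>F induced G E = G"
    if G: "rooted_forest G" "verts G = verts F" "edges G \<subseteq> edges F \<union> edges \<mu>" for G
  proof (rule forest_eqI)
    have cl: "(x \<in> D \<longleftrightarrow> y \<in> D) \<and> (x \<in> E \<longleftrightarrow> y \<in> E) \<and> x \<in> verts F" if "(x, y) \<in> edges G" for x y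
      using edgeF[of x y] that G(3) edge_verts[OF G(1) that] G(2) by blast
    show "verts (induced G D \<uplus>\<^sub>F induced G E) = verts G" using DE G(2) by auto
    show "edges (induced G D \<uplus>\<^sub>F induced G E) = edges G" using DE cl by auto
    show "roots (induced G D \<uplus>\<^sub>F induced G E) = roots G"
    proof -
      have "roots (induced G C) = roots G \<inter> C" if "C = D \<or> C = E" for C
        using roots_induced_closed[OF G(1), of C] cl that by blast
      moreover have "roots G \<subseteq> D \<union> E" using rooted_forestD(5)[OF G(1)] G(2) DE(1) by auto
      ultimately show ?thesis unfolding forest_union_simps(3) by auto
    qed
  qed
  \<comment> \<open>Only inside \<open>R\<close> can an additive edge run between the two sides;
    elsewhere its ends have the same representative.\<close>
  have add2_split: "add2 A = (add2 A \<inter> Pow D) \<union> (add2 A \<inter> Pow E) \<union>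
      (add2 A \<inter> {{a, b} |a b. a \<in> X \<and> b \<in> R - X})"
  proof -
    have "e \<subseteq> D \<or> e \<subseteq> E \<or> (\<exists>a\<in>X. \<exists>b\<in>R - X. e = {a, b})" if "e \<in> add2 A" for e
    proof -
      obtain x y where e: "e = {x, y}" "x \<noteq> y" and f: "mfraternal F \<mu> {x, y}"
        using \<open>e \<in> add2 A\<close> by (rule add2E)
      have v: "x \<in> verts F" "y \<in> verts F" using mfraternal_verts[OF f] by auto
      show ?thesis
      proof (cases "x \<in> R")
        case True
        then have "y \<in> R" using mfraternal_meets_common_roots[OF f] by blast
        then show ?thesis using True e XDE by (auto simp: doubleton_eq_iff)
      next
        case False
        then have "rep x = rep y" using f same by (auto simp: mfraternal_iff)
        then show ?thesis using e v rep(1) by (auto simp: D_def E_def)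
      qed
    qed
    then show ?thesis by blast
  qed
  \<comment> \<open>\<open>with_arena\<close> joins the common roots of its two factors, so these
    have to be exactly the two blocks of \<open>R\<close>.\<close>
  have cr: "common_roots (restrict_arena A D) = X" "common_roots (restrict_arena A E) = R - X"
  proof -
    have "common_roots (restrict_arena A C) = R \<inter> C" if "C = D \<or> C = E" for C
      using roots_induced_closed[OF structures(1), of C] roots_induced_closed[OF structures(2), of C]
        edgeF that unfolding common_roots_def restrict_arena_def arena.simps by blast
    then show "common_roots (restrict_arena A D) = X" "common_roots (restrict_arena A E) = R - X"
      using XDE by auto
  qed
  have "add0 A \<subseteq> verts F" using structures(5) by (auto simp: additive_structure_def leaf_def)
  then have a0: "add0 A = add0 A \<inter> D \<union> add0 A \<inter> E" using DE by blast
  note parts = un[OF structures(1)] un[OF structures(2,3)] expo_union_restrict[OF exp_side DE(2)]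
  have "A = tensor_arena (restrict_arena A D) (restrict_arena A E) \<or>
     A = with_arena (restrict_arena A D) (restrict_arena A E)"
    using cross
  proof
    assume "\<forall>x\<in>X. \<forall>y\<in>R - X. {x, y} \<in> add2 A"
    then have "add2 A = (add2 A \<inter> Pow D) \<union> (add2 A \<inter> Pow E) \<union> {{a, b} |a b. a \<in> X \<and> b \<in> R - X}"
      using add2_split by blast
    then have "A = with_arena (restrict_arena A D) (restrict_arena A E)"
      unfolding with_arena_def tensor_arena_def cr using parts a0
      by (simp add: restrict_arena_def)
    then show ?thesis ..
  next
    assume "\<forall>x\<in>X. \<forall>y\<in>R - X. {x, y} \<notin> add2 A"
    then have "add2 A = (add2 A \<inter> Pow D) \<union> (add2 A \<inter> Pow E)"
      using add2_split by blast
    then have "A = tensor_arena (restrict_arena A D) (restrict_arena A E)"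
      unfolding tensor_arena_def using parts a0 by (simp add: restrict_arena_def)
    then show ?thesis ..
  qed
  moreover have "D \<subset> verts F" "E \<subset> verts F" using DE XDE X Rv by blast+
  ultimately show ?thesis using that spl disjoint_arenas_restrict[OF DE(2)] by blast
qed

section \<open>A single common root: one and linear implication\<close>

lemma one_decomposition:
  assumes r: "R = {r}" "r \<in> add0 A" and noR: "\<And>V. V \<in> verts \<epsilon> \<Longrightarrow> fst V \<noteq> R"
  shows "A = one_arena r"
proof -
  have rv: "r \<in> roots F" "r \<in> roots \<mu>" "r \<in> verts F" using common_rootsD r by blast+
  \<comment> \<open>An element of \<open>add0\<close> is a leaf of \<open>F\<close> and not
    switching, so it has no children in either forest.\<close>
  have lF: "(r, y) \<notin> edges F" and l\<mu>: "(r, y) \<notin> edges \<mu>" for y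
    using r structures(3,5) by (auto simp: additive_structure_def leaf_def switching_def children_def)
  \<comment> \<open>The \<mu>-root above an \<open>F\<close>-root is a common root, hence
    \<open>r\<close>, which has no \<mu>-children.\<close>
  have F_root: "v = r" if "v \<in> roots F" for v
  proof -
    have v: "v \<in> verts \<mu>" using that rooted_forestD(5)[OF structures(1)] structures(3) by blast
    obtain m where m: "m \<in> roots \<mu>" "(m, v) \<in> (edges \<mu>)\<^sup>*"
      using root_above_unique[OF structures(2) v] by blast
    have "m \<in> roots F" using mult_ancestor_of_root[OF m(2) that] .
    then have "m = r" using m r by (auto simp: common_roots_def)
    then show ?thesis using m(2) l\<mu> by (metis converse_rtranclE)
  qed
  have verts: "v = r" if "v \<in> verts F" for v
    using structures(1) that by (induction rule: forest_top_down_induct) (use F_root lF in auto)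
  then have V: "verts F = {r}" using rv by blast
  have "edges F = {}" "edges \<mu> = {}"
    using lF l\<mu> verts edge_verts[OF structures(1)] edge_verts[OF structures(2)] structures(3) by fast+
  then have 1: "F = point r" "\<mu> = point r"
    using V structures(3) rv rooted_forestD(5)[OF structures(1)] rooted_forestD(5)[OF structures(2)]
    by (auto intro!: forest_eqI simp: point_def)
  \<comment> \<open>An exponential set would be a nonempty subset of \<open>{r}\<close>, that is
    \<open>R\<close>, which \<open>noR\<close> excludes.\<close>
  have "verts \<epsilon> = {}"
    using noR mfraternal_verts[OF expo_mfraternal] expo_nonempty V r(1) by (metis all_not_in_conv subset_singletonD)
  then have 2: "\<epsilon> = empty_forest"
    using edge_verts[OF structures(7)] rooted_forestD(5)[OF structures(7)]
    by (auto intro!: forest_eqI simp: empty_forest_def)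
  have "add0 A \<subseteq> verts F" using structures(5) by (auto simp: additive_structure_def leaf_def)
  then have 3: "add0 A = {r}" using V r by blast
  have 4: "add2 A = {}"
  proof (rule ccontr)
    assume "add2 A \<noteq> {}"
    then obtain e where "e \<in> add2 A" by blast
    then obtain x y where "x \<noteq> y" "mfraternal F \<mu> {x, y}" by (rule add2E)
    then show False using mfraternal_verts[of "{x, y}"] V by simp
  qed
  show ?thesis using 1 2 3 4 unfolding one_arena_def by simp
qed

text \<open>\<open>D\<close> consists of the proper descendants of \<open>r\<close> in
  \<open>F\<close>, and \<open>E\<close> of the trees at the other roots of \<open>F\<close>. As
  \<open>r\<close> is the only common root, those other roots are not roots of \<mu>; they hang
  below \<open>r\<close> in \<mu>, which is the tree of roots that a linear implication has. If
  \<open>E\<close> is empty, the second part is top and the result is a negation.\<close>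

lemma lolli_decomposition:
  assumes r: "R = {r}" "r \<notin> add0 A" and noR: "\<And>V. V \<in> verts \<epsilon> \<Longrightarrow> fst V \<noteq> R"
  obtains D E where "splittable_arena (restrict_arena A D)" "splittable_arena (restrict_arena A E)"
    "disjoint_arenas (restrict_arena A D) (restrict_arena A E)"
    "A = lolli_arena r (restrict_arena A D) (restrict_arena A E)" "r \<notin> D" "r \<notin> E"
    "D \<subset> verts F" "E \<subset> verts F"
proof -
  note F = structures(1) and \<mu> = structures(2)
  have rv: "r \<in> roots F" "r \<in> roots \<mu>" "r \<in> verts F" using common_rootsD r by blast+
  have noF: "(p, r) \<notin> edges F" and no\<mu>: "(p, r) \<notin> edges \<mu>" for p
    using rv rooted_forestD(5)[OF F] rooted_forestD(5)[OF \<mu>] by blast+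
  obtain f where f_all: "\<forall>v\<in>roots F. f v = v" "\<forall>x y. (x, y) \<in> edges F \<longrightarrow> f x = f y"
    using ex_root_function[OF F] by blast
  note f = f_all[rule_format]
  define D where "D = {v \<in> verts F. v \<noteq> r \<and> f v = r}"
  define E where "E = {v \<in> verts F. f v \<noteq> r}"
  have fr: "f r = r" using f rv by blast
  have rDE: "r \<notin> D" "r \<notin> E" using fr by (auto simp: D_def E_def)
  have DE: "insert r (D \<union> E) = verts F" "D \<inter> E = {}" using rv by (auto simp: D_def E_def)
  have Droot: "v \<notin> roots F" if "v \<in> D" for v using that f(1) by (auto simp: D_def)
  \<comment> \<open>Siblings with a common parent lie under the same root, and the roots other than
    \<open>r\<close> all belong to \<open>E\<close>.\<close>
  have sib: "(x \<in> D \<longleftrightarrow> y \<in> D) \<and> (x \<in> E \<longleftrightarrow> y \<in> E)"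
    if xy: "siblings F x y" "x \<noteq> r" "y \<noteq> r" for x y
  proof (cases "x \<in> roots F")
    case True
    then have "y \<in> roots F" using siblings_root[OF F xy(1)] by blast
    then show ?thesis using True f(1) xy siblings_verts[OF F xy(1)] by (auto simp: D_def E_def)
  next
    case False
    then obtain p where "(p, x) \<in> edges F" "(p, y) \<in> edges F" using xy by (auto simp: siblings_def)
    then have "f x = f y" using f(2) by metis
    then show ?thesis using xy siblings_verts[OF F xy(1)] by (auto simp: D_def E_def)
  qed
  have eF: "(x \<in> E \<longleftrightarrow> y \<in> E) \<and> (y \<in> D \<longleftrightarrow> x = r \<or> x \<in> D) \<and> y \<noteq> r \<and> x \<in> verts F \<and> y \<in> verts F"
    if "(x, y) \<in> edges F" for x y
    using f(2)[OF that] edge_verts[OF F that] that noF fr by (auto simp: D_def E_def)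
  \<comment> \<open>The two forests treat \<open>r\<close> differently: its children in
    \<open>F\<close> belong to the premise \<open>D\<close>, while its children in \<mu>, being
    roots of \<open>F\<close>, belong to the conclusion \<open>E\<close>.\<close>
  have e\<mu>: "(x \<in> D \<longleftrightarrow> y \<in> D) \<and> (y \<in> E \<longleftrightarrow> x = r \<or> x \<in> E) \<and> y \<noteq> r \<and> x \<in> verts F \<and> y \<in> verts F \<and>
      (x \<in> roots F \<longleftrightarrow> y \<in> roots F)"
    if "(x, y) \<in> edges \<mu>" for x y
  proof -
    have y: "y \<noteq> r" using that no\<mu> by blast
    have s: "siblings F x y" using mult_edge_siblings[OF that] .
    note v = siblings_verts[OF F s] and rt = siblings_root[OF F s]
    show ?thesis
    proof (cases "x = r")
      case True
      then have "y \<in> roots F" using rt rv by blast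
      then show ?thesis using True y v rt f(1) fr by (auto simp: D_def E_def)
    next
      case False
      then show ?thesis using sib[OF s False y] y v rt by blast
    qed
  qed
  have mroot: "(\<exists>p. (p, v) \<in> edges \<mu>)" if "v \<in> roots F" "v \<noteq> r" for v
    using that r rooted_forestD(5)[OF F] rooted_forestD(5)[OF \<mu>] structures(3)
    by (auto simp: common_roots_def)
  have exp_side: "fst V \<subseteq> D \<or> fst V \<subseteq> E" if V: "V \<in> verts \<epsilon>" for V
  proof -
    note m = expo_mfraternal[OF V]
    have "r \<notin> fst V"
      using mfraternal_meets_common_roots[OF m] noR[OF V] r(1) by auto
    have "(x \<in> D \<longleftrightarrow> y \<in> D) \<and> (x \<in> E \<longleftrightarrow> y \<in> E)" if "x \<in> fst V" "y \<in> fst V" for x y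
    proof -
      have "siblings F x y" using that m by (simp add: mfraternal_iff)
      then show ?thesis using sib[of x y] that \<open>r \<notin> fst V\<close> by metis
    qed
    moreover have "fst V \<subseteq> D \<union> E"
      using mfraternal_verts[OF m] \<open>r \<notin> fst V\<close> unfolding DE(1)[symmetric] by blast
    ultimately show ?thesis by blast
  qed
  \<comment> \<open>The roots of the premise were children of \<open>r\<close>, so they are siblings
    in \<open>F\<close> already.\<close>
  have roots_D: "v \<in> roots (induced F D) \<longleftrightarrow> (r, v) \<in> edges F" for v
  proof
    assume v: "v \<in> roots (induced F D)"
    then have "v \<in> D" "v \<in> verts F" "\<forall>p\<in>D. (p, v) \<notin> edges F" by auto
    then show "(r, v) \<in> edges F" using Droot[of v] rooted_forestD(5)[OF F] eF by metis
  next
    assume "(r, v) \<in> edges F"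
    then show "v \<in> roots (induced F D)"
      using eF[of r v] rooted_forestD(4)[OF F] rDE by auto
  qed
  have splD: "splittable_arena (restrict_arena A D)"
  proof (rule splittable_arena_restrict)
    show "siblings F x y \<and> siblings \<mu> x y"
      if s: "siblings (induced F D) x y" "siblings (induced \<mu> D) x y" for x y
    proof
      show "siblings \<mu> x y" using siblings_induced_closed[OF \<mu> s(2)] e\<mu> by blast
      show "siblings F x y"
        using s(1) roots_D[of x] roots_D[of y] unfolding siblings_def induced_simps(2) by blast
    qed
    show "fst V \<subseteq> D" if "V \<in> verts \<epsilon>" "fst V \<inter> D \<noteq> {}" for V
      using exp_side[OF that(1)] that(2) DE(2) by blast
  qed
  have splE: "splittable_arena (restrict_arena A E)"
  proof (rule splittable_arena_restrict)
    show "siblings F x y \<and> siblings \<mu> x y"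
      if s: "siblings (induced F E) x y" "siblings (induced \<mu> E) x y" for x y
    proof
      show F_sib: "siblings F x y" using siblings_induced_closed[OF F s(1)] eF by blast
      \<comment> \<open>In the conclusion, old roots of \<mu> and former \<mu>-children of
        \<open>r\<close> become siblings in \<mu>. Being a root of \<open>F\<close> tells them
        apart, and siblings in \<open>F\<close> agree on that.\<close>
      have root: "if v \<in> roots F then (r, v) \<in> edges \<mu> else v \<in> roots \<mu>"
        if v: "v \<in> roots (induced \<mu> E)" for v
      proof -
        have v': "v \<in> E" "v \<in> verts \<mu>" "\<forall>p\<in>E. (p, v) \<notin> edges \<mu>" using v by auto
        have par: "p = r" if "(p, v) \<in> edges \<mu>" for p using that e\<mu>[OF that] v' by blast
        show ?thesis
        proof (cases "v \<in> roots F")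
          case True
          then show ?thesis using mroot[of v] par v' rDE by fastforce
        next
          case False
          then have "(p, v) \<notin> edges \<mu>" for p using par e\<mu> rv(1) by blast
          then show ?thesis using False v' rooted_forestD(5)[OF \<mu>] by auto
        qed
      qed
      show "siblings \<mu> x y"
        using s(2) root[of x] root[of y] siblings_root[OF F F_sib]
        by (auto simp: siblings_def split: if_splits)
    qed
    show "fst V \<subseteq> E" if "V \<in> verts \<epsilon>" "fst V \<inter> E \<noteq> {}" for V
      using exp_side[OF that(1)] that(2) DE(2) by blast
  qed
  have roots_E: "roots (induced F E) = roots F - {r}"
  proof -
    have "roots F \<inter> E = roots F - {r}" using Droot DE rDE rooted_forestD(5)[OF F] by blast
    then show ?thesis using roots_induced_closed[OF F, of E] eF by blast
  qed
  have 1: "F = add_root r (induced F D) \<uplus>\<^sub>F induced F E"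
  proof (rule forest_eqI)
    show "verts F = verts (add_root r (induced F D) \<uplus>\<^sub>F induced F E)" using DE by auto
    have "(x, y) \<in> edges F \<longleftrightarrow> (x = r \<and> (r, y) \<in> edges F) \<or> (x, y) \<in> edges F \<inter> D \<times> D \<or>
        (x, y) \<in> edges F \<inter> E \<times> E" for x y
      using eF[of x y] DE by auto
    then show "edges F = edges (add_root r (induced F D) \<uplus>\<^sub>F induced F E)"
      unfolding forest_union_simps(2) add_root_simps(2) using roots_D by auto
    show "roots F = roots (add_root r (induced F D) \<uplus>\<^sub>F induced F E)"
      unfolding forest_union_simps(3) add_root_simps(3) roots_E using rv by blast
  qed
  \<comment> \<open>These are the roots of the conclusion's forest, the set along which
    \<open>lolli_arena\<close> cuts \<mu> into the part below \<open>r\<close> and the part left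
    alone.\<close>
  define E0 where "E0 = roots F - {r}"
  have vE: "verts F \<inter> E = E" "verts F \<inter> D = D" using DE by auto
  have E0: "E0 \<subseteq> E" using roots_E by (auto simp: E0_def)
  let ?\<mu>1 = "induced (induced \<mu> E) (E - E0)"
  let ?\<mu>2 = "induced (induced \<mu> E) E0"
  \<comment> \<open>Each vertex of \<open>E0\<close> has a \<mu>-parent, which is again a root of
    \<open>F\<close>; it is missing from \<open>E0\<close> only if it is \<open>r\<close>.\<close>
  have root\<mu>2: "v \<in> roots ?\<mu>2 \<longleftrightarrow> (r, v) \<in> edges \<mu>" for v
  proof
    assume "v \<in> roots ?\<mu>2"
    then have v: "v \<in> E0" "v \<in> E" "\<And>p. p \<in> E0 \<Longrightarrow> p \<in> E \<Longrightarrow> (p, v) \<notin> edges \<mu>" by auto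
    then obtain p where p: "(p, v) \<in> edges \<mu>" using mroot by (auto simp: E0_def)
    then have "p \<in> roots F" using e\<mu>[OF p] v by (auto simp: E0_def)
    then have "p = r" using v(3)[of p] p E0 by (auto simp: E0_def)
    then show "(r, v) \<in> edges \<mu>" using p by simp
  next
    assume "(r, v) \<in> edges \<mu>"
    then show "v \<in> roots ?\<mu>2"
      using e\<mu>[of r v] rooted_forestD(4)[OF \<mu>] rDE rv structures(3) by (auto simp: E0_def)
  qed
  have 2: "\<mu> = induced \<mu> D \<uplus>\<^sub>F ?\<mu>1 \<uplus>\<^sub>F add_root r ?\<mu>2"
  proof (rule forest_eqI)
    show "verts \<mu> = verts (induced \<mu> D \<uplus>\<^sub>F ?\<mu>1 \<uplus>\<^sub>F add_root r ?\<mu>2)"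
      using DE E0 structures(3) by auto
    have "(x, y) \<in> edges \<mu> \<longleftrightarrow> (x, y) \<in> edges (induced \<mu> D) \<or> (x, y) \<in> edges ?\<mu>1 \<or>
        (x = r \<and> (r, y) \<in> edges \<mu>) \<or> (x, y) \<in> edges ?\<mu>2" for x y
      using e\<mu>[of x y] DE rDE by (auto simp: E0_def)
    then show "edges \<mu> = edges (induced \<mu> D \<uplus>\<^sub>F ?\<mu>1 \<uplus>\<^sub>F add_root r ?\<mu>2)"
      unfolding forest_union_simps(2) add_root_simps(2) using root\<mu>2 by auto
    have "v \<in> roots (induced \<mu> D) \<longleftrightarrow> v \<in> roots \<mu> \<and> v \<in> D" for v
      using roots_induced_closed[OF \<mu>, of D] e\<mu> by blast
    moreover have "v \<in> roots ?\<mu>1 \<longleftrightarrow> v \<in> roots \<mu> \<and> v \<in> E - E0" for v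
    proof -
      have "p \<in> E - E0" if "(p, v) \<in> edges \<mu>" "v \<in> E - E0" for p
        using that e\<mu>[OF that(1)] rv rDE by (auto simp: E0_def)
      then show ?thesis using rooted_forestD(5)[OF \<mu>, of v] unfolding induced_simps by blast
    qed
    moreover have "v \<notin> roots \<mu>" if "v \<in> E0" for v
      using that mroot[of v] rooted_forestD(5)[OF \<mu>] by (auto simp: E0_def)
    moreover have "v \<in> verts F" if "v \<in> roots \<mu>" for v
      using that rooted_forestD(5)[OF \<mu>] structures(3) by blast
    ultimately show "roots \<mu> = roots (induced \<mu> D \<uplus>\<^sub>F ?\<mu>1 \<uplus>\<^sub>F add_root r ?\<mu>2)"
      unfolding forest_union_simps(3) add_root_simps(3) using rv DE by blast
  qed
  have "add0 A \<subseteq> verts F" using structures(5) by (auto simp: additive_structure_def leaf_def)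
  then have 3: "add0 A = add0 A \<inter> D \<union> add0 A \<inter> E"
    using r(2) unfolding DE(1)[symmetric] by blast
  have "e \<subseteq> D \<or> e \<subseteq> E" if e2: "e \<in> add2 A" for e
  proof -
    obtain x y where e: "e = {x, y}" "x \<noteq> y" and m: "mfraternal F \<mu> {x, y}"
      using e2 by (rule add2E)
    \<comment> \<open>A fraternal set containing \<open>r\<close> lies in \<open>R\<close>, which is
      too small for the two ends of an additive edge.\<close>
    have "r \<notin> {x, y}" using mfraternal_meets_common_roots[OF m] e(2) unfolding r(1) by auto
    then have "(x \<in> D \<longleftrightarrow> y \<in> D) \<and> (x \<in> E \<longleftrightarrow> y \<in> E)" using m sib[of x y] by (auto simp: mfraternal_iff)
    then show ?thesis
      using e mfraternal_verts[OF m] \<open>r \<notin> {x, y}\<close> unfolding DE(1)[symmetric] by blast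
  qed
  then have 4: "add2 A = add2 A \<inter> Pow D \<union> add2 A \<inter> Pow E" by blast
  note 5 = expo_union_restrict[OF exp_side DE(2)]
  have fE: "frst (restrict_arena A E) = induced F E" by (simp add: restrict_arena_def)
  have "A = lolli_arena r (restrict_arena A D) (restrict_arena A E)"
  proof (rule arena.equality)
    show "mult A = mult (lolli_arena r (restrict_arena A D) (restrict_arena A E))"
      using 2 unfolding lolli_arena_def fE roots_E by (simp add: restrict_arena_def E0_def vE)
  qed (use 1 3 4 5 in \<open>simp_all add: lolli_arena_def restrict_arena_def\<close>)
  moreover have "D \<subset> verts F" "E \<subset> verts F" using DE rDE by blast+
  ultimately show ?thesis using that splD splE disjoint_arenas_restrict[OF DE(2)] rDE by blast
qed

section \<open>The decreasing measure and the induction\<close>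

lemma card_restrict_less:
  assumes "D \<subset> verts F"
  shows "card (verts (frst (restrict_arena A D))) + card (verts (expo (restrict_arena A D))) <
    card (verts F) + card (verts \<epsilon>)"
proof -
  have "card (verts F \<inter> D) < card (verts F)"
    using assms rooted_forestD(1)[OF structures(1)] by (intro psubset_card_mono) auto
  moreover have "card (verts \<epsilon> \<inter> Pow D \<times> UNIV) \<le> card (verts \<epsilon>)"
    using rooted_forestD(1)[OF structures(7)] by (intro card_mono) auto
  ultimately show ?thesis by (simp add: restrict_arena_def)
qed

lemma top_decomposition:
  assumes "verts F = {}"
  shows "A = top_arena"
proof -
  have empty: "G = empty_forest" if "rooted_forest G" "verts G = {}" for G
    using that edge_verts[OF that(1)] rooted_forestD(5)[OF that(1)]
    by (auto intro!: forest_eqI simp: empty_forest_def)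
  have "verts \<epsilon> = {}" using mfraternal_verts[OF expo_mfraternal] expo_nonempty assms by blast
  moreover have "add0 A = {}" using assms structures(5) by (auto simp: additive_structure_def leaf_def)
  moreover have "add2 A = {}" using assms add2E mfraternal_verts by (metis all_not_in_conv insert_subset)
  moreover have "F = empty_forest" "\<mu> = empty_forest" "\<epsilon> = empty_forest"
    using empty structures(1,2,3,7) \<open>verts \<epsilon> = {}\<close> assms by simp_all
  ultimately show ?thesis unfolding top_arena_def by simp
qed

end

text \<open>Restrictions lose a vertex of the forest, whereas undoing an of-course keeps the forest
  and loses a vertex of \<epsilon>. The sum of the two sizes decreases either way.\<close>

lemma splittable_arena_obtainable: "splittable_arena A \<Longrightarrow> obtainable A"
proof (induction "card (verts (frst A)) + card (verts (expo A))" arbitrary: A rule: less_induct)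
  case less
  interpret splittable_arena A by fact
  \<comment> \<open>A nonempty forest has a common root, so the cases on \<open>R\<close> are
    exhaustive.\<close>
  consider "verts F = {}" | V where "V \<in> verts \<epsilon>" "fst V = R"
    | "R \<noteq> {}" "\<not> is_singleton R" "\<And>V. V \<in> verts \<epsilon> \<Longrightarrow> fst V \<noteq> R"
    | r where "R = {r}" "\<And>V. V \<in> verts \<epsilon> \<Longrightarrow> fst V \<noteq> R"
    using common_roots_nonempty unfolding is_singleton_def by blast
  then show ?case
  proof cases
    case 1
    then show ?thesis using top_decomposition obtainable.top by simp
  next
    case 2
    then obtain A' i where "splittable_arena A'" "A = ofcourse_arena i A'" "common_roots A' \<noteq> {}"
      "i \<notin> snd ` verts (expo A')" "verts (frst A') = verts F" "card (verts (expo A')) < card (verts \<epsilon>)"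
      by (rule ofcourse_decomposition)
    then show ?thesis using less.hyps[of A'] obtainable.ofcourse[of A' i] by simp
  next
    case 3
    then obtain D E where
      "splittable_arena (restrict_arena A D)" "splittable_arena (restrict_arena A E)"
      "disjoint_arenas (restrict_arena A D) (restrict_arena A E)"
      "A = tensor_arena (restrict_arena A D) (restrict_arena A E) \<or>
       A = with_arena (restrict_arena A D) (restrict_arena A E)"
      "D \<subset> verts F" "E \<subset> verts F"
      by (rule product_decomposition)
    then show ?thesis
      using less.hyps card_restrict_less obtainable.tensor obtainable.amp by metis
  next
    case (4 r)
    show ?thesis
    proof (cases "r \<in> add0 A")
      case True
      then show ?thesis using one_decomposition[of r] 4 obtainable.one by metis
    next
      case False
      obtain D E where
        DE: "splittable_arena (restrict_arena A D)" "splittable_arena (restrict_arena A E)"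
        "disjoint_arenas (restrict_arena A D) (restrict_arena A E)"
        "A = lolli_arena r (restrict_arena A D) (restrict_arena A E)" "r \<notin> D" "r \<notin> E"
        "D \<subset> verts F" "E \<subset> verts F"
        by (rule lolli_decomposition[OF 4(1) False 4(2)])
      have "r \<notin> verts (frst (restrict_arena A D)) \<union> verts (frst (restrict_arena A E))"
        using DE by (simp add: restrict_arena_def)
      then show ?thesis
        using less.hyps card_restrict_less DE obtainable.lolli by metis
    qed
  qed
qed

lemma forest_iso_id: "forest_iso id F F"
  by (simp add: forest_iso_def)

lemma arena_iso_refl: "A \<cong>\<^sub>A A"
  unfolding arena_iso_def by (intro exI[of _ id] conjI forest_iso_id) auto

theorem mainTheorem1:
  fixes A :: "'v arena"
  assumes "combinatorial_arena A"
  shows "\<exists>B :: 'v arena. obtainable B \<and> A \<cong>\<^sub>A B"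
  using combinatorial_arena_imp_splittable[OF assms] splittable_arena_obtainable arena_iso_refl by blast

end
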